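(* Let $(k_n)$ be a sequence of positive integers, and let $p_n,q_n\in(0,1)$ be such that $$p_n-q_n=o(n^{-1})$$ and $$p_n^{1/2}(1-p_n)^{1/2}+q_n^{1/2}(1-q_n)^{1/2}=o\bigl(n|p_n-q_n|\bigr)$$ (or, instead of the second condition, $p_n,q_n\to0$ and $n(p_n^{1/2}-q_n^{1/2})\to\infty$). For every $n\geq 1$ let $\theta_{0,n}\in\Theta_n$ be given and equip $\Theta_n$ with its uniform prior $\Pi_n$. Let $b_n=\Pi_n(B_n(\theta_{0,n}))$ and $d_n=\rho_n^{C\alpha_n|p_n-q_n|}$ for some constant $C>1$ (with $B_n(\cdot),\rho_n,\alpha_n$ as defined in the context). Let $D_n(X^n)$ be a sequence of credible sets of credible levels $1-a_n$, for some sequence $(a_n)$, $0\le a_n\le 1$, such that $b_n^{-1}a_n=o(d_n)$. Then the sets $C_n(X^n)$ associated with $D_n(X^n)$ under $B_n$ satisfy $$P_{\theta_{0,n},n}\bigl(\theta_{0,n}\in C_n(X^n)\bigr)\to1\qquad(n\to\infty),$$ i.e. the $C_n(X^n)$ are asymptotic confidence sets.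
   Context: Planted bi-section model. For $n\ge1$, $\Theta_n'$ is the set of $\theta'\in\{0,1\}^{2n}$ with exactly $n$ zeros and $n$ ones. Let $\neg\theta'$ denote component-wise negation, let $\sim_n$ be the equivalence relation identifying $\theta'$ with $\neg\theta'$, and let $\Theta_n=\Theta_n'/\sim_n$. Given $p_n,q_n\in(0,1)$ and $\theta\in\Theta_n$ with representative $\theta'$, $P_{\theta,n}$ is the law of the random simple undirected graph $X^n$ (no loops) on vertices $\{1,\dots,2n\}$, with adjacency indicators $X_{ij}$ ($i<j$), whose edges occur independently with $P_{\theta,n}(X_{ij}=1)=p_n$ if $\theta'_i=\theta'_j$ and $=q_n$ if $\theta'_i\ne\theta'_j$ (independent of the representative). $\mathscr X_n$ is the finite set of such graphs. Let $p_{\theta,n}(x^n)=P_{\theta,n}(X^n=x^n)$. With the uniform prior on $\Theta_n$, the posterior is, for $A\subset\Theta_n$, $$\Pi(A|X^n)=\sum_{\theta\in A}p_{\theta,n}(X^n)\Big/\sum_{\theta\in\Theta_n}p_{\theta,n}(X^n).$$ A sequence of credible sets of credible levels $1-a_n$ is a sequence of set-valued maps $D_n$ from $\mathscr X_n$ to subsets of $\Theta_n$ with $\Pi(\Theta_n\setminus D_n(X^n)|X^n)\le a_n$ (almost surely under $P_n^\Pi=|\Theta_n|^{-1}\sum_{\theta\in\Theta_n}P_{\theta,n}$). Metric on $\Theta_n$: with $Z(\theta')=\{i:\theta'_i=0\}$, $k'(\theta_1',\theta_2')=|Z(\theta_1')\setminus Z(\theta_2')|$, and $k(\theta_1,\theta_2)=\min\{k'(\theta_1',\theta_2'),k'(\theta_1',\neg\theta_2')\}$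 for representatives $\theta_i'$ of $\theta_i$. Balls: $B_n(\theta)=\{\eta\in\Theta_n:k(\eta,\theta)\le k_n\}$, $B_n=B_n(\theta_{0,n})$. A set $C\subset\Theta_n$ is associated with $D\subset\Theta_n$ under $B_n$ if $B_n(\theta)\cap D=\emptyset$ for all $\theta\in\Theta_n\setminus C$; in particular the $k_n$-enlargement $\{\theta:\exists\,\eta\in D,\ k(\eta,\theta)\le k_n\}$ is associated with $D$. Rates: $$\rho_n=\min\Bigl\{\tfrac{1-p_n}{p_n}\tfrac{q_n}{1-q_n},\ \tfrac{p_n}{1-p_n}\tfrac{1-q_n}{q_n}\Bigr\},\qquad \alpha_n=\frac1{|B_n|}\sum_{\theta\in B_n}2k(\theta_{0,n},\theta)\bigl(n-k(\theta_{0,n},\theta)\bigr).$$ *)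

theory Defs
  imports
    "HOL-Probability.Probability"
    "HOL-Probability.Product_PMF"
    "HOL-Library.FuncSet"
    "HOL-Library.Landau_Symbols"
begin

text \<open>
  Elements of \<open>{0,1}\<^sup>2\<^sup>n\<close> are extensional functions on \<open>{1..2n}\<close>; the parameter space is the
  quotient itself, whose elements are the classes \<open>{\<theta>', \<not>\<theta>'}\<close>.
\<close>

definition labellings :: "nat \<Rightarrow> (nat \<Rightarrow> nat) set" where
  "labellings n = {\<theta>' \<in> {1..2*n} \<rightarrow>\<^sub>E {0, 1}.
     card {i \<in> {1..2*n}. \<theta>' i = 0} = n \<and> card {i \<in> {1..2*n}. \<theta>' i = 1} = n}"

definition neg_lab :: "nat \<Rightarrow> (nat \<Rightarrow> nat) \<Rightarrow> (nat \<Rightarrow> nat)" where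
  "neg_lab n \<theta>' = (\<lambda>i\<in>{1..2*n}. 1 - \<theta>' i)"

definition lab_rel :: "nat \<Rightarrow> ((nat \<Rightarrow> nat) \<times> (nat \<Rightarrow> nat)) set" where
  "lab_rel n = {(\<theta>', \<eta>'). \<theta>' \<in> labellings n \<and> \<eta>' \<in> labellings n \<and>
     (\<eta>' = \<theta>' \<or> \<eta>' = neg_lab n \<theta>')}"

definition Theta :: "nat \<Rightarrow> (nat \<Rightarrow> nat) set set" where
  "Theta n = labellings n // lab_rel n"

text \<open>
  Functions of a class are defined through this representative; the lemmas \<open>planted_law_eq\<close>
  and \<open>kdist_eq\<close> below show that the choice does not matter.
\<close>

definition rep :: "(nat \<Rightarrow> nat) set \<Rightarrow> (nat \<Rightarrow> nat)" where
  "rep \<theta> = (SOME \<theta>'. \<theta>' \<in> \<theta>)"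

text \<open>
  A simple graph on \<open>{1..2n}\<close> is its set of edges, an edge being a two-element vertex set.
\<close>

definition vpairs :: "nat \<Rightarrow> (nat \<times> nat) set" where
  "vpairs n = {(i, j). i \<in> {1..2*n} \<and> j \<in> {1..2*n} \<and> i < j}"

definition graphs :: "nat \<Rightarrow> nat set set set" where
  "graphs n = Pow {{i, j} | i j. (i, j) \<in> vpairs n}"

definition graph_of :: "nat \<Rightarrow> (nat \<times> nat \<Rightarrow> bool) \<Rightarrow> nat set set" where
  "graph_of n X = {{i, j} | i j. (i, j) \<in> vpairs n \<and> X (i, j)}"

definition lab_law :: "nat \<Rightarrow> real \<Rightarrow> real \<Rightarrow> (nat \<Rightarrow> nat) \<Rightarrow> nat set set pmf" where
  "lab_law n p q \<theta>' = map_pmf (graph_of n)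
     (Pi_pmf (vpairs n) False
        (\<lambda>(i, j). bernoulli_pmf (if \<theta>' i = \<theta>' j then p else q)))"

definition planted_law :: "nat \<Rightarrow> real \<Rightarrow> real \<Rightarrow> (nat \<Rightarrow> nat) set \<Rightarrow> nat set set pmf" where
  "planted_law n p q \<theta> = lab_law n p q (rep \<theta>)"

definition prior :: "nat \<Rightarrow> (nat \<Rightarrow> nat) set pmf" where
  "prior n = pmf_of_set (Theta n)"

definition prior_predictive :: "nat \<Rightarrow> real \<Rightarrow> real \<Rightarrow> nat set set pmf" where
  "prior_predictive n p q = bind_pmf (prior n) (planted_law n p q)"

definition posterior ::
    "nat \<Rightarrow> real \<Rightarrow> real \<Rightarrow> (nat \<Rightarrow> nat) set set \<Rightarrow> nat set set \<Rightarrow> real" where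
  "posterior n p q A x =
     (\<Sum>\<theta>\<in>A. pmf (planted_law n p q \<theta>) x) / (\<Sum>\<theta>\<in>Theta n. pmf (planted_law n p q \<theta>) x)"

definition credible_sets ::
    "(nat \<Rightarrow> real) \<Rightarrow> (nat \<Rightarrow> real) \<Rightarrow> (nat \<Rightarrow> real) \<Rightarrow>
     (nat \<Rightarrow> nat set set \<Rightarrow> (nat \<Rightarrow> nat) set set) \<Rightarrow> bool" where
  "credible_sets p q a D \<longleftrightarrow> (\<forall>n\<ge>1.
     (\<forall>x\<in>graphs n. D n x \<subseteq> Theta n) \<and>
     (AE x in measure_pmf (prior_predictive n (p n) (q n)).
        posterior n (p n) (q n) (Theta n - D n x) x \<le> a n))"

definition zeros :: "nat \<Rightarrow> (nat \<Rightarrow> nat) \<Rightarrow> nat set" where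
  "zeros n \<theta>' = {i \<in> {1..2*n}. \<theta>' i = 0}"

definition kdist' :: "nat \<Rightarrow> (nat \<Rightarrow> nat) \<Rightarrow> (nat \<Rightarrow> nat) \<Rightarrow> nat" where
  "kdist' n \<theta>' \<eta>' = card (zeros n \<theta>' - zeros n \<eta>')"

definition kdist :: "nat \<Rightarrow> (nat \<Rightarrow> nat) set \<Rightarrow> (nat \<Rightarrow> nat) set \<Rightarrow> nat" where
  "kdist n \<theta> \<eta> = min (kdist' n (rep \<theta>) (rep \<eta>)) (kdist' n (rep \<theta>) (neg_lab n (rep \<eta>)))"

definition kball :: "nat \<Rightarrow> nat \<Rightarrow> (nat \<Rightarrow> nat) set \<Rightarrow> (nat \<Rightarrow> nat) set set" where
  "kball n r \<theta> = {\<eta> \<in> Theta n. kdist n \<eta> \<theta> \<le> r}"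

definition associated ::
    "nat \<Rightarrow> nat \<Rightarrow> (nat \<Rightarrow> nat) set set \<Rightarrow> (nat \<Rightarrow> nat) set set \<Rightarrow> bool" where
  "associated n r C D \<longleftrightarrow> C \<subseteq> Theta n \<and> (\<forall>\<theta> \<in> Theta n - C. kball n r \<theta> \<inter> D = {})"

definition rho :: "real \<Rightarrow> real \<Rightarrow> real" where
  "rho p q = min ((1 - p) / p * (q / (1 - q))) (p / (1 - p) * ((1 - q) / q))"

definition alpha :: "nat \<Rightarrow> nat \<Rightarrow> (nat \<Rightarrow> nat) set \<Rightarrow> real" where
  "alpha n r \<theta>\<^sub>0 = 1 / real (card (kball n r \<theta>\<^sub>0)) *
     (\<Sum>\<theta>\<in>kball n r \<theta>\<^sub>0. 2 * real (kdist n \<theta>\<^sub>0 \<theta>) * (real n - real (kdist n \<theta>\<^sub>0 \<theta>)))"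

lemma finite_vpairs: "finite (vpairs n)"
  by (rule finite_subset[of _ "{1..2*n} \<times> {1..2*n}"]) (auto simp: vpairs_def)

lemma finite_labellings: "finite (labellings n)"
  unfolding labellings_def by (rule finite_subset[OF Collect_subset]) (auto intro: finite_PiE)

lemma labellings_values: "\<theta>' \<in> labellings n \<Longrightarrow> i \<in> {1..2*n} \<Longrightarrow> \<theta>' i = 0 \<or> \<theta>' i = 1"
  unfolding labellings_def by (auto simp: PiE_iff)

lemma neg_lab_in:
  assumes "\<theta>' \<in> labellings n"
  shows "neg_lab n \<theta>' \<in> labellings n"
proof -
  have "{i \<in> {1..2*n}. neg_lab n \<theta>' i = 0} = {i \<in> {1..2*n}. \<theta>' i = 1}"
    "{i \<in> {1..2*n}. neg_lab n \<theta>' i = 1} = {i \<in> {1..2*n}. \<theta>' i = 0}"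
    using labellings_values[OF assms] by (force simp: neg_lab_def)+
  moreover have "neg_lab n \<theta>' \<in> {1..2*n} \<rightarrow>\<^sub>E {0, 1}"
    using labellings_values[OF assms] unfolding neg_lab_def by force
  ultimately show ?thesis using assms unfolding labellings_def by simp
qed

lemma neg_lab_neg_lab:
  assumes "\<theta>' \<in> labellings n"
  shows "neg_lab n (neg_lab n \<theta>') = \<theta>'"
proof
  fix i
  show "neg_lab n (neg_lab n \<theta>') i = \<theta>' i"
  proof (cases "i \<in> {1..2*n}")
    case True
    then show ?thesis using labellings_values[OF assms True] by (auto simp: neg_lab_def)
  next
    case False
    then show ?thesis using assms
      unfolding labellings_def PiE_def extensional_def neg_lab_def restrict_def by auto
  qed
qed

lemma equiv_lab_rel: "equiv (labellings n) (lab_rel n)"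
  unfolding equiv_def refl_on_def sym_def trans_def lab_rel_def
  using neg_lab_neg_lab by auto

lemma finite_Theta: "finite (Theta n)"
  unfolding Theta_def quotient_def using finite_labellings by auto

lemma labellings_nonempty: "labellings n \<noteq> {}"
proof -
  let ?f = "\<lambda>i\<in>{1..2*n}. if i \<le> n then 0 else 1 :: nat"
  have "{i \<in> {1..2*n}. ?f i = 0} = {1..n}" "{i \<in> {1..2*n}. ?f i = 1} = {n+1..2*n}"
    by (auto split: if_splits)
  then have "?f \<in> labellings n"
    unfolding labellings_def by auto
  then show ?thesis by blast
qed

lemma Theta_nonempty: "Theta n \<noteq> {}"
  unfolding Theta_def quotient_def using labellings_nonempty by auto

lemma Theta_class:
  assumes "\<theta> \<in> Theta n" "\<theta>' \<in> \<theta>"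
  shows "\<theta>' \<in> labellings n" "\<theta> = {\<theta>', neg_lab n \<theta>'}"
proof -
  obtain \<eta>' where e: "\<eta>' \<in> labellings n" "\<theta> = lab_rel n `` {\<eta>'}"
    using assms(1) unfolding Theta_def by (elim quotientE)
  have "\<theta> = {\<eta>', neg_lab n \<eta>'}"
    using e neg_lab_in[OF e(1)] unfolding lab_rel_def by auto
  then show "\<theta>' \<in> labellings n" "\<theta> = {\<theta>', neg_lab n \<theta>'}"
    using assms(2) e(1) neg_lab_in[OF e(1)] neg_lab_neg_lab[OF e(1)] by auto
qed

lemma rep_in:
  assumes "\<theta> \<in> Theta n"
  shows "rep \<theta> \<in> \<theta>"
proof -
  have "\<theta> \<noteq> {}"
    using assms in_quotient_imp_non_empty[OF equiv_lab_rel] unfolding Theta_def by blast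
  then show ?thesis unfolding rep_def by (simp add: some_in_eq)
qed

lemma rep_cases:
  assumes "\<theta> \<in> Theta n" "\<theta>' \<in> \<theta>"
  shows "rep \<theta> = \<theta>' \<or> rep \<theta> = neg_lab n \<theta>'"
  using rep_in[OF assms(1)] Theta_class(2)[OF assms] by auto

lemma lab_law_neg_lab:
  assumes "\<theta>' \<in> labellings n"
  shows "lab_law n p q (neg_lab n \<theta>') = lab_law n p q \<theta>'"
proof -
  have "neg_lab n \<theta>' i = neg_lab n \<theta>' j \<longleftrightarrow> \<theta>' i = \<theta>' j" if "(i, j) \<in> vpairs n" for i j
  proof -
    have ij: "i \<in> {1..2*n}" "j \<in> {1..2*n}" using that by (auto simp: vpairs_def)
    show ?thesis using labellings_values[OF assms ij(1)] labellings_values[OF assms ij(2)] ij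
      by (auto simp: neg_lab_def)
  qed
  then show ?thesis unfolding lab_law_def
    by (intro arg_cong[where f = "map_pmf (graph_of n)"] Pi_pmf_cong) auto
qed

lemma planted_law_eq:
  assumes "\<theta> \<in> Theta n" "\<theta>' \<in> \<theta>"
  shows "planted_law n p q \<theta> = lab_law n p q \<theta>'"
  using rep_cases[OF assms] lab_law_neg_lab[OF Theta_class(1)[OF assms]]
  unfolding planted_law_def by metis

lemma zeros_neg_lab:
  assumes "\<theta>' \<in> labellings n"
  shows "zeros n (neg_lab n \<theta>') = {1..2*n} - zeros n \<theta>'"
  using labellings_values[OF assms] by (force simp: zeros_def neg_lab_def)

lemma card_zeros: "\<theta>' \<in> labellings n \<Longrightarrow> card (zeros n \<theta>') = n"
  unfolding labellings_def zeros_def by simp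

lemma kdist'_commute:
  assumes "\<theta>' \<in> labellings n" "\<eta>' \<in> labellings n"
  shows "kdist' n \<theta>' \<eta>' = kdist' n \<eta>' \<theta>'"
proof -
  have f: "finite (zeros n \<theta>')" "finite (zeros n \<eta>')" by (auto simp: zeros_def)
  show ?thesis unfolding kdist'_def
    using card_Diff_subset_Int[of "zeros n \<theta>'" "zeros n \<eta>'"]
      card_Diff_subset_Int[of "zeros n \<eta>'" "zeros n \<theta>'"] f card_zeros assms
    by (simp add: Int_commute)
qed

lemma kdist'_neg_lab_neg_lab:
  assumes "\<theta>' \<in> labellings n" "\<eta>' \<in> labellings n"
  shows "kdist' n (neg_lab n \<theta>') (neg_lab n \<eta>') = kdist' n \<theta>' \<eta>'"
proof -
  have "zeros n (neg_lab n \<theta>') - zeros n (neg_lab n \<eta>') = zeros n \<eta>' - zeros n \<theta>'"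
    unfolding zeros_neg_lab[OF assms(1)] zeros_neg_lab[OF assms(2)] by (auto simp: zeros_def)
  then have "kdist' n (neg_lab n \<theta>') (neg_lab n \<eta>') = kdist' n \<eta>' \<theta>'"
    unfolding kdist'_def by simp
  then show ?thesis using kdist'_commute[OF assms] by simp
qed

lemma kdist_eq:
  assumes "\<theta> \<in> Theta n" "\<theta>' \<in> \<theta>" "\<eta> \<in> Theta n" "\<eta>' \<in> \<eta>"
  shows "kdist n \<theta> \<eta> = min (kdist' n \<theta>' \<eta>') (kdist' n \<theta>' (neg_lab n \<eta>'))"
proof -
  note t = Theta_class(1)[OF assms(1,2)] and e = Theta_class(1)[OF assms(3,4)]
  have 1: "kdist' n (neg_lab n \<theta>') (neg_lab n \<eta>') = kdist' n \<theta>' \<eta>'"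
    by (rule kdist'_neg_lab_neg_lab[OF t e])
  have 2: "kdist' n (neg_lab n \<theta>') \<eta>' = kdist' n \<theta>' (neg_lab n \<eta>')"
    using kdist'_neg_lab_neg_lab[OF t neg_lab_in[OF e]] neg_lab_neg_lab[OF e] by simp
  from rep_cases[OF assms(1,2)] rep_cases[OF assms(3,4)] show ?thesis
    unfolding kdist_def by (elim disjE) (simp_all add: 1 2 neg_lab_neg_lab[OF e] min.commute)
qed

lemma pmf_prior_predictive:
  "pmf (prior_predictive n p q) x =
     (\<Sum>\<theta>\<in>Theta n. pmf (planted_law n p q \<theta>) x) / real (card (Theta n))"
  unfolding prior_predictive_def prior_def
  by (simp add: pmf_bind_pmf_of_set finite_Theta Theta_nonempty)

lemma set_planted_law: "set_pmf (planted_law n p q \<theta>) \<subseteq> graphs n"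
  unfolding planted_law_def lab_law_def graphs_def graph_of_def by auto

lemma associated_enlargement:
  "associated n r {\<theta> \<in> Theta n. \<exists>\<eta>\<in>D. kdist n \<eta> \<theta> \<le> r} D"
  unfolding associated_def kball_def by auto

end

theory Submission
  imports Defs
begin

text \<open>
  If \<open>\<theta>\<^sub>0\<close> is missed by the confidence set, then the whole ball \<open>B\<close> around \<open>\<theta>\<^sub>0\<close> avoids the credible
  set, so its posterior mass is at most \<open>a\<close> (\<open>credible_miss_low_ball\<close>). Summed over all graphs where
  this happens, the average of the laws \<open>P\<^sub>\<theta>\<close> over \<open>\<theta> \<in> B\<close> gives the event probability at most \<open>a / b\<close>,
  with \<open>b\<close> the prior mass of \<open>B\<close>. What has to be shown is that the single law \<open>P\<^sub>\<theta>\<^sub>0\<close> cannot be much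
  larger than this average: up to an event of vanishing \<open>P\<^sub>\<theta>\<^sub>0\<close>-probability, the average is at least
  \<open>d = \<rho> powr (c * \<alpha> * \<bar>p - q\<bar>)\<close> times \<open>P\<^sub>\<theta>\<^sub>0\<close>. Then the miss probability is at most \<open>a / (b * d)\<close> plus
  the probability of the exceptional event.
\<close>

text \<open>
  By convexity of the exponential, the average of the likelihood ratios over \<open>B\<close> is at least the
  exponential of the average log-likelihood ratio. That average is a linear statistic of the edge
  indicators, and here the symmetry of the ball enters. Permuting the vertices inside the blocks of
  \<open>\<theta>\<^sub>0\<close> maps \<open>B\<close> to itself, so all pairs inside a block carry the same weight, and so do all pairs across
  the blocks (\<open>sum_pair_change_kball\<close>). Hence the average log-likelihood ratio equals \<open>\<alpha> * \<lambda> * U\<close>,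
  where \<open>\<lambda>\<close> is the logarithm of the odds ratio of \<open>q\<close> to \<open>p\<close> and \<open>U\<close> is the edge density inside the
  blocks minus the edge density across them (\<open>ball_likelihood_ge\<close>).
\<close>

text \<open>
  Under \<open>P\<^sub>\<theta>\<^sub>0\<close> the statistic \<open>U\<close> has mean \<open>p - q\<close> and variance of order
  \<open>(p * (1 - p) + q * (1 - q)) / n\<^sup>2\<close>, which either form of the separation condition makes negligible
  against \<open>(p - q)\<^sup>2\<close> (\<open>relative_variance_tendsto_0\<close>). As \<open>c > 1\<close>, Chebyshev's inequality gives
  \<open>\<bar>U\<bar> < c * \<bar>p - q\<bar>\<close> with probability tending to one. Since \<open>ln \<rho> = - \<bar>\<lambda>\<bar>\<close>, this yields
  \<open>exp (\<alpha> * \<lambda> * U) \<ge> d\<close>. The resulting bound, valid for every \<open>n \<ge> 2\<close>, is \<open>low_posterior_ball_prob\<close>.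
\<close>

section \<open>Second moments of sums over a product distribution\<close>

lemma expectation_Pi_pmf_insert:
  fixes h :: "('a \<Rightarrow> 'b) \<Rightarrow> real"
  assumes "finite A" "x \<notin> A" "\<And>e. e \<in> insert x A \<Longrightarrow> finite (set_pmf (p e))"
  shows "measure_pmf.expectation (Pi_pmf (insert x A) d p) h =
    measure_pmf.expectation (p x)
      (\<lambda>y. measure_pmf.expectation (Pi_pmf A d p) (\<lambda>f. h (f(x := y))))"
proof -
  have fin: "finite (set_pmf (Pi_pmf A d p))"
    by (rule finite_subset[OF set_Pi_pmf_subset'[OF assms(1)]]) (use assms in auto)
  have "measure_pmf.expectation (Pi_pmf (insert x A) d p) h =
    (\<Sum>y\<in>set_pmf (p x). pmf (p x) y *\<^sub>R
      measure_pmf.expectation (map_pmf (\<lambda>f. f(x := y)) (Pi_pmf A d p)) h)"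
    unfolding Pi_pmf_insert'[OF assms(1,2)] map_pmf_def[symmetric]
    by (rule pmf_expectation_bind) (use assms fin in auto)
  also have "\<dots> = measure_pmf.expectation (p x)
      (\<lambda>y. measure_pmf.expectation (Pi_pmf A d p) (\<lambda>f. h (f(x := y))))"
    by (subst integral_measure_pmf[of "set_pmf (p x)"]) (use assms in auto)
  finally show ?thesis .
qed

text \<open>
  The variances of independent summands add up. The first moment is carried along because the cross
  term in the induction step is a multiple of it.
\<close>
lemma centred_sum_Pi_pmf_moments:
  fixes g :: "'a \<Rightarrow> 'b \<Rightarrow> real"
  assumes "finite A" "\<And>e. e \<in> A \<Longrightarrow> finite (set_pmf (p e))"
    and "\<And>e. e \<in> A \<Longrightarrow> measure_pmf.expectation (p e) (g e) = 0"
  shows "measure_pmf.expectation (Pi_pmf A d p) (\<lambda>f. \<Sum>e\<in>A. g e (f e)) = 0 \<and>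
    measure_pmf.expectation (Pi_pmf A d p) (\<lambda>f. (\<Sum>e\<in>A. g e (f e))\<^sup>2)
      = (\<Sum>e\<in>A. measure_pmf.expectation (p e) (\<lambda>y. (g e y)\<^sup>2))"
  using assms
proof (induction A rule: finite_induct)
  case empty
  then show ?case by simp
next
  case (insert x A)
  have fin: "finite (set_pmf (Pi_pmf A d p))"
    by (rule finite_subset[OF set_Pi_pmf_subset'[OF insert.hyps(1)]]) (use insert in auto)
  note [simp] = integrable_measure_pmf_finite[OF fin]
    integrable_measure_pmf_finite[OF insert.prems(1)[of x]]
  let ?S = "\<lambda>f. \<Sum>e\<in>A. g e (f e)"
  have upd: "(\<Sum>e\<in>insert x A. g e ((f(x := y)) e)) = g x y + ?S f" for f y
  proof -
    have "(\<Sum>e\<in>A. g e ((f(x := y)) e)) = ?S f"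
      by (rule sum.cong) (use insert.hyps in auto)
    then show ?thesis using insert.hyps by simp
  qed
  have IH: "measure_pmf.expectation (Pi_pmf A d p) ?S = 0"
    "measure_pmf.expectation (Pi_pmf A d p) (\<lambda>f. (?S f)\<^sup>2)
      = (\<Sum>e\<in>A. measure_pmf.expectation (p e) (\<lambda>y. (g e y)\<^sup>2))"
    using insert by auto
  have 1: "measure_pmf.expectation (Pi_pmf A d p) (\<lambda>f. g x y + ?S f) = g x y" for y
    by (subst Bochner_Integration.integral_add) (simp_all add: IH(1))
  have 2: "measure_pmf.expectation (Pi_pmf A d p) (\<lambda>f. (g x y + ?S f)\<^sup>2)
      = (g x y)\<^sup>2 + (\<Sum>e\<in>A. measure_pmf.expectation (p e) (\<lambda>y. (g e y)\<^sup>2))" for y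
  proof -
    have "measure_pmf.expectation (Pi_pmf A d p) (\<lambda>f. (g x y + ?S f)\<^sup>2)
      = measure_pmf.expectation (Pi_pmf A d p) (\<lambda>f. ((g x y)\<^sup>2 + (2 * g x y) * ?S f) + (?S f)\<^sup>2)"
      by (simp add: power2_sum algebra_simps)
    also have "\<dots> = (g x y)\<^sup>2 + (2 * g x y) * measure_pmf.expectation (Pi_pmf A d p) ?S
        + measure_pmf.expectation (Pi_pmf A d p) (\<lambda>f. (?S f)\<^sup>2)"
      by simp
    finally show ?thesis by (simp add: IH)
  qed
  have split: "measure_pmf.expectation (Pi_pmf (insert x A) d p) h =
    measure_pmf.expectation (p x)
      (\<lambda>y. measure_pmf.expectation (Pi_pmf A d p) (\<lambda>f. h (f(x := y))))" for h :: "_ \<Rightarrow> real"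
    by (rule expectation_Pi_pmf_insert) (use insert in auto)
  show ?case
    unfolding split upd 1 2 using insert.prems(2)[of x] insert.hyps by simp
qed

section \<open>Likelihood ratios and linear edge statistics\<close>

definition same_block :: "(nat \<Rightarrow> nat) \<Rightarrow> nat \<times> nat \<Rightarrow> bool" where
  "same_block t e \<longleftrightarrow> t (fst e) = t (snd e)"

definition edge_prob :: "real \<Rightarrow> real \<Rightarrow> (nat \<Rightarrow> nat) \<Rightarrow> nat \<times> nat \<Rightarrow> real" where
  "edge_prob p q t e = (if same_block t e then p else q)"

definition adj :: "nat set set \<Rightarrow> nat \<times> nat \<Rightarrow> bool" where
  "adj x e \<longleftrightarrow> {fst e, snd e} \<in> x"

lemma lab_law_alt:
  "lab_law n p q t = map_pmf (graph_of n)
     (Pi_pmf (vpairs n) False (\<lambda>e. bernoulli_pmf (edge_prob p q t e)))"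
  unfolding lab_law_def edge_prob_def same_block_def by (simp add: case_prod_unfold)

lemma adj_graph_of: "e \<in> vpairs n \<Longrightarrow> adj (graph_of n X) e = X e"
proof (cases e)
  case (Pair i j)
  assume "e \<in> vpairs n"
  then show ?thesis unfolding Pair adj_def graph_of_def vpairs_def
    by (auto simp: doubleton_eq_iff)
qed

lemma graph_of_adj:
  assumes "x \<in> graphs n"
  shows "graph_of n (\<lambda>e. e \<in> vpairs n \<and> adj x e) = x"
  using assms unfolding graph_of_def graphs_def adj_def by simp blast

lemma pmf_lab_law:
  assumes "x \<in> graphs n" "0 < p" "p < 1" "0 < q" "q < 1"
  shows "pmf (lab_law n p q t) x =
    (\<Prod>e\<in>vpairs n. if adj x e then edge_prob p q t e else 1 - edge_prob p q t e)"
proof -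
  let ?M = "Pi_pmf (vpairs n) False (\<lambda>e. bernoulli_pmf (edge_prob p q t e))"
  let ?X = "\<lambda>e. e \<in> vpairs n \<and> adj x e"
  have ep: "0 \<le> edge_prob p q t e" "edge_prob p q t e \<le> 1" for e
    using assms by (auto simp: edge_prob_def)
  have "pmf (lab_law n p q t) x = measure_pmf.prob ?M (graph_of n -` {x})"
    unfolding lab_law_alt by (rule pmf_map)
  also have "\<dots> = measure_pmf.prob ?M (graph_of n -` {x} \<inter> set_pmf ?M)"
    by (simp add: measure_Int_set_pmf)
  also have "graph_of n -` {x} \<inter> set_pmf ?M = {?X} \<inter> set_pmf ?M"
  proof -
    have "X = ?X" if "X \<in> set_pmf ?M" "graph_of n X = x" for X
    proof
      fix e
      show "X e = ?X e"
        using subsetD[OF set_Pi_pmf_subset[OF finite_vpairs] that(1)] that(2) adj_graph_of[of e n X]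
        by (cases e, cases "e \<in> vpairs n") auto
    qed
    then show ?thesis using graph_of_adj[OF assms(1)] by auto
  qed
  also have "measure_pmf.prob ?M ({?X} \<inter> set_pmf ?M) = pmf ?M ?X"
    by (simp add: measure_Int_set_pmf measure_pmf_single)
  also have "\<dots> = (\<Prod>e\<in>vpairs n. if adj x e then edge_prob p q t e else 1 - edge_prob p q t e)"
    by (subst pmf_Pi') (auto intro!: prod.cong simp: finite_vpairs ep)
  finally show ?thesis .
qed

text \<open>
  Only pairs whose status (same block or different blocks) differs between \<open>s\<close> and \<open>t\<close> contribute. A
  pair that is separated by \<open>s\<close> but not by \<open>t\<close> replaces \<open>p\<close> by \<open>q\<close>, which multiplies the likelihood by
  \<open>(1 - q) / (1 - p)\<close>, and by the odds ratio on top of that if the edge is present; a pair that is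
  joined by \<open>s\<close> only contributes the inverse factor.
\<close>
lemma ln_likelihood_ratio:
  assumes "x \<in> graphs n" "0 < p" "p < 1" "0 < q" "q < 1"
  defines "kap \<equiv> ln ((1 - q) / (1 - p))" and "lam \<equiv> ln (q * (1 - p) / (p * (1 - q)))"
  shows "pmf (lab_law n p q t) x > 0"
    and "ln (pmf (lab_law n p q s) x / pmf (lab_law n p q t) x) =
      (\<Sum>e\<in>vpairs n. (of_bool (same_block t e) - of_bool (same_block s e)) * (lam * of_bool (adj x e) + kap))"
proof -
  let ?f = "\<lambda>t e. if adj x e then edge_prob p q t e else 1 - edge_prob p q t e"
  have f: "?f t e > 0" for t e using assms by (auto simp: edge_prob_def)
  note P = pmf_lab_law[OF assms(1-5)]
  show pos: "pmf (lab_law n p q t) x > 0" for t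
    unfolding P by (intro prod_pos) (use f in auto)
  have "ln (pmf (lab_law n p q s) x / pmf (lab_law n p q t) x) = (\<Sum>e\<in>vpairs n. ln (?f s e)) - (\<Sum>e\<in>vpairs n. ln (?f t e))"
    using pos[of s] pos[of t] f ln_prod[of "vpairs n" "?f s"] ln_prod[of "vpairs n" "?f t"]
    by (simp add: ln_div P finite_vpairs less_imp_neq[THEN not_sym])
  also have "\<dots> = (\<Sum>e\<in>vpairs n. (of_bool (same_block t e) - of_bool (same_block s e)) * (lam * of_bool (adj x e) + kap))"
    unfolding sum_subtractf[symmetric]
  proof (rule sum.cong[OF refl])
    fix e
    have "lam = ln q + ln (1 - p) - ln p - ln (1 - q)" "kap = ln (1 - q) - ln (1 - p)"
      using assms(2-5) unfolding lam_def kap_def by (simp_all add: ln_div ln_mult)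
    then show "ln (?f s e) - ln (?f t e) =
        (of_bool (same_block t e) - of_bool (same_block s e)) * (lam * of_bool (adj x e) + kap)"
      by (simp add: edge_prob_def)
  qed
  finally show "ln (pmf (lab_law n p q s) x / pmf (lab_law n p q t) x) =
      (\<Sum>e\<in>vpairs n. (of_bool (same_block t e) - of_bool (same_block s e)) * (lam * of_bool (adj x e) + kap))" .
qed

text \<open>
  Chebyshev's inequality, with the variance of a weighted sum of independent Bernoulli variables.
\<close>
lemma edge_statistic_deviation:
  fixes u :: "nat \<times> nat \<Rightarrow> real"
  assumes "0 < p" "p < 1" "0 < q" "q < 1" "\<tau> > 0"
  shows "measure_pmf.prob (lab_law n p q t)
      {x. \<tau> \<le> \<bar>(\<Sum>e\<in>vpairs n. u e * of_bool (adj x e)) - (\<Sum>e\<in>vpairs n. u e * edge_prob p q t e)\<bar>}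
    \<le> (\<Sum>e\<in>vpairs n. (u e)\<^sup>2 * (edge_prob p q t e * (1 - edge_prob p q t e))) / \<tau>\<^sup>2"
proof -
  define r where "r = edge_prob p q t"
  have r: "0 \<le> r e" "r e \<le> 1" for e using assms by (auto simp: edge_prob_def r_def)
  let ?M = "Pi_pmf (vpairs n) False (\<lambda>e. bernoulli_pmf (r e))"
  define g where "g = (\<lambda>e y. u e * (of_bool y - r e))"
  let ?S = "\<lambda>X. \<Sum>e\<in>vpairs n. g e (X e)"
  have fin: "finite (set_pmf ?M)"
    by (rule finite_subset[OF set_Pi_pmf_subset'[OF finite_vpairs]]) (auto simp: finite_vpairs)
  note [simp] = integrable_measure_pmf_finite[OF fin]
  have "(\<Sum>e\<in>vpairs n. u e * of_bool (adj (graph_of n X) e)) - (\<Sum>e\<in>vpairs n. u e * r e) = ?S X" for X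
    unfolding sum_subtractf[symmetric] by (rule sum.cong) (auto simp: adj_graph_of g_def algebra_simps)
  then have "measure_pmf.prob (lab_law n p q t)
      {x. \<tau> \<le> \<bar>(\<Sum>e\<in>vpairs n. u e * of_bool (adj x e)) - (\<Sum>e\<in>vpairs n. u e * r e)\<bar>}
    = measure_pmf.prob ?M {X. \<tau> \<le> \<bar>?S X\<bar>}"
    unfolding lab_law_alt r_def[symmetric] by simp
  also have "\<dots> \<le> measure_pmf.expectation ?M (\<lambda>X. (?S X)\<^sup>2) / \<tau>\<^sup>2"
    using measure_pmf.second_moment_method[of ?S ?M \<tau>] assms by simp
  also have "measure_pmf.expectation ?M (\<lambda>X. (?S X)\<^sup>2)
      = (\<Sum>e\<in>vpairs n. measure_pmf.expectation (bernoulli_pmf (r e)) (\<lambda>y. (g e y)\<^sup>2))"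
    using centred_sum_Pi_pmf_moments[OF finite_vpairs, where p = "\<lambda>e. bernoulli_pmf (r e)" and g = g and d = False] r
    by (simp add: g_def algebra_simps)
  also have "\<dots> = (\<Sum>e\<in>vpairs n. (u e)\<^sup>2 * (r e * (1 - r e)))"
    using r by (intro sum.cong) (auto simp: g_def power2_eq_square algebra_simps)
  finally show ?thesis unfolding r_def .
qed


section \<open>Counting pairs in a bisection\<close>

lemma sum_agreements:
  fixes s :: "nat \<Rightarrow> nat"
  assumes "finite A" "finite B" "\<And>i. i \<in> A \<union> B \<Longrightarrow> s i = 0 \<or> s i = 1"
  defines "m \<equiv> \<lambda>V. real (card {i \<in> V. s i = 0})"
  shows "(\<Sum>i\<in>A. \<Sum>j\<in>B. of_bool (s i = s j)) =
    m A * m B + (real (card A) - m A) * (real (card B) - m B)"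
proof -
  let ?z = "\<lambda>i. of_bool (s i = 0) :: real"
  have z: "sum ?z V = m V" if "finite V" for V
    using that by (simp add: m_def of_bool_def sum.If_cases Int_def)
  \<comment> \<open>Agreement splits into a product of indicators for each of the two labels.\<close>
  have "(\<Sum>i\<in>A. \<Sum>j\<in>B. of_bool (s i = s j)) =
      (\<Sum>i\<in>A. \<Sum>j\<in>B. ?z i * ?z j + (1 - ?z i) * (1 - ?z j))"
  proof (intro sum.cong refl)
    fix i j assume "i \<in> A" "j \<in> B"
    then show "of_bool (s i = s j) = ?z i * ?z j + (1 - ?z i) * (1 - ?z j)"
      using assms(3)[of i] assms(3)[of j] by auto
  qed
  also have "\<dots> = sum ?z A * sum ?z B + (\<Sum>i\<in>A. 1 - ?z i) * (\<Sum>j\<in>B. 1 - ?z j)"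
    by (simp only: sum.distrib sum_product)
  also have "\<dots> = m A * m B + (real (card A) - m A) * (real (card B) - m B)"
    by (simp add: sum_subtractf z[OF assms(1)] z[OF assms(2)])
  finally show ?thesis .
qed

lemma sum_ordered_pairs:
  fixes h :: "nat \<Rightarrow> nat \<Rightarrow> real"
  assumes "\<And>i j. h i j = h j i"
  shows "(\<Sum>i\<in>{1..2*n}. \<Sum>j\<in>{1..2*n}. h i j) =
    (\<Sum>i\<in>{1..2*n}. h i i) + 2 * (\<Sum>e\<in>vpairs n. h (fst e) (snd e))"
proof -
  let ?V = "{1..2*n}" and ?h = "\<lambda>e. h (fst e) (snd e)"
  let ?d = "(\<lambda>i. (i, i)) ` ?V" and ?r = "prod.swap ` vpairs n"
  have V: "?V \<times> ?V = ?d \<union> (vpairs n \<union> ?r)"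
    by (auto simp: vpairs_def image_iff)
  have "(\<Sum>i\<in>?V. \<Sum>j\<in>?V. h i j) = sum ?h (?d \<union> (vpairs n \<union> ?r))"
    unfolding V[symmetric] sum.cartesian_product by (simp add: case_prod_unfold)
  also have "\<dots> = sum ?h ?d + (sum ?h (vpairs n) + sum ?h ?r)"
  proof -
    have "?d \<inter> (vpairs n \<union> ?r) = {}" "vpairs n \<inter> ?r = {}"
      by (auto simp: vpairs_def)
    then show ?thesis by (simp add: sum.union_disjoint finite_vpairs)
  qed
  also have "sum ?h ?d = (\<Sum>i\<in>?V. h i i)"
    by (subst sum.reindex) (auto simp: inj_on_def)
  also have "sum ?h ?r = sum ?h (vpairs n)"
    by (subst sum.reindex) (auto intro!: sum.cong assms)
  finally show ?thesis by simp
qed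

text \<open>
  The numbers of pairs inside and across the blocks follow from the \<open>2 * n\<^sup>2\<close> ordered pairs of
  vertices with equal label, of which \<open>2 * n\<close> are diagonal.
\<close>
lemma sum_same_block_vpairs:
  fixes f :: "bool \<Rightarrow> real"
  assumes "t \<in> labellings n"
  shows "(\<Sum>e\<in>vpairs n. f (same_block t e)) = real n * (real n - 1) * f True + (real n)\<^sup>2 * f False"
proof -
  have c: "card {i \<in> {1..2*n}. t i = 0} = n" using assms by (simp add: labellings_def)
  have "(\<Sum>i\<in>{1..2*n}. \<Sum>j\<in>{1..2*n}. of_bool (t i = t j)) = 2 * real n * real n"
    using labellings_values[OF assms] by (subst sum_agreements, simp_all only: c) auto
  moreover have "(\<Sum>i\<in>{1..2*n}. \<Sum>j\<in>{1..2*n}. of_bool (t i = t j)) =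
      (\<Sum>i\<in>{1..2*n}. of_bool (t i = t i)) + 2 * (\<Sum>e\<in>vpairs n. of_bool (t (fst e) = t (snd e)) :: real)"
    by (rule sum_ordered_pairs) (simp only: eq_commute)
  ultimately have "2 * real n * real n = 2 * real n + 2 * (\<Sum>e\<in>vpairs n. of_bool (same_block t e))"
    by (simp add: same_block_def del: sum_of_bool_eq)
  then have W: "(\<Sum>e\<in>vpairs n. of_bool (same_block t e)) = real n * (real n - 1)"
    by (simp add: algebra_simps)
  have N: "(\<Sum>e\<in>vpairs n. 1) = real n * (2 * real n - 1)"
    using sum_ordered_pairs[of "\<lambda>i j. 1" n] by (simp add: algebra_simps)
  have "(\<Sum>e\<in>vpairs n. f (same_block t e)) =
      (\<Sum>e\<in>vpairs n. (f True - f False) * of_bool (same_block t e) + f False * 1)"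
    by (rule sum.cong) auto
  also have "\<dots> = (f True - f False) * (\<Sum>e\<in>vpairs n. of_bool (same_block t e))
      + f False * (\<Sum>e\<in>vpairs n. 1)"
    unfolding sum.distrib sum_distrib_left ..
  finally show ?thesis unfolding W N by (simp add: algebra_simps power2_eq_square)
qed

section \<open>Invariance of the balls under vertex permutations\<close>

definition relabel :: "(nat \<Rightarrow> nat) \<Rightarrow> (nat \<Rightarrow> nat) set \<Rightarrow> (nat \<Rightarrow> nat) set" where
  "relabel \<pi> \<theta> = (\<lambda>t. t \<circ> \<pi>) ` \<theta>"

lemma comp_permutation_labellings:
  assumes "\<pi> permutes {1..2*n}" "t \<in> labellings n"
  shows "t \<circ> \<pi> \<in> labellings n"
    and "neg_lab n (t \<circ> \<pi>) = neg_lab n t \<circ> \<pi>"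
    and "zeros n (t \<circ> \<pi>) = \<pi> -` zeros n t"
proof -
  have \<pi>: "\<pi> i \<in> {1..2*n} \<longleftrightarrow> i \<in> {1..2*n}" for i
    using permutes_in_image[OF assms(1)] .
  have c: "card {i \<in> {1..2*n}. (t \<circ> \<pi>) i = b} = card {i \<in> {1..2*n}. t i = b}" for b
  proof -
    have "{i \<in> {1..2*n}. (t \<circ> \<pi>) i = b} = \<pi> -` {i \<in> {1..2*n}. t i = b}"
      using \<pi> by auto
    then show ?thesis
      using card_vimage_inj[OF permutes_inj[OF assms(1)], of "{i \<in> {1..2*n}. t i = b}"]
        permutes_surj[OF assms(1)] by simp
  qed
  have "t \<in> {1..2*n} \<rightarrow>\<^sub>E {0, 1}" using assms(2) by (simp add: labellings_def)
  then have "t \<circ> \<pi> \<in> {1..2*n} \<rightarrow>\<^sub>E {0, 1}"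
    using \<pi> permutes_not_in[OF assms(1)] by (intro PiE_I) (metis PiE_mem comp_apply, metis PiE_arb comp_apply)
  then show "t \<circ> \<pi> \<in> labellings n" using c assms(2) by (simp add: labellings_def)
  show "neg_lab n (t \<circ> \<pi>) = neg_lab n t \<circ> \<pi>"
    using \<pi> permutes_not_in[OF assms(1)] by (auto simp: neg_lab_def fun_eq_iff restrict_def)
  show "zeros n (t \<circ> \<pi>) = \<pi> -` zeros n t"
    using \<pi> by (auto simp: zeros_def)
qed

lemma relabel_in_Theta:
  assumes "\<pi> permutes {1..2*n}" "\<theta> \<in> Theta n"
  shows "relabel \<pi> \<theta> \<in> Theta n"
proof -
  have t: "rep \<theta> \<in> labellings n" and \<theta>: "\<theta> = {rep \<theta>, neg_lab n (rep \<theta>)}"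
    using Theta_class[OF assms(2) rep_in[OF assms(2)]] by auto
  note C = comp_permutation_labellings[OF assms(1) t]
  have "relabel \<pi> \<theta> = {rep \<theta> \<circ> \<pi>, neg_lab n (rep \<theta> \<circ> \<pi>)}"
    unfolding relabel_def C(2) by (subst \<theta>) simp
  also have "\<dots> = lab_rel n `` {rep \<theta> \<circ> \<pi>}"
    using C(1) neg_lab_in[OF C(1)] by (auto simp: lab_rel_def)
  finally show ?thesis unfolding Theta_def using C(1) by (auto intro: quotientI)
qed

lemma kdist'_comp_permutation:
  assumes "\<pi> permutes {1..2*n}" "s \<in> labellings n" "t \<in> labellings n"
  shows "kdist' n (s \<circ> \<pi>) (t \<circ> \<pi>) = kdist' n s t"
  unfolding kdist'_def comp_permutation_labellings(3)[OF assms(1,2)]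
    comp_permutation_labellings(3)[OF assms(1,3)] vimage_Diff[symmetric]
  by (rule card_vimage_inj[OF permutes_inj[OF assms(1)]]) (simp add: permutes_surj[OF assms(1)])

lemma kdist_relabel:
  assumes "\<pi> permutes {1..2*n}" "\<theta> \<in> Theta n" "\<eta> \<in> Theta n"
  shows "kdist n (relabel \<pi> \<theta>) (relabel \<pi> \<eta>) = kdist n \<theta> \<eta>"
proof -
  note s = Theta_class(1)[OF assms(2) rep_in[OF assms(2)]]
  note t = Theta_class(1)[OF assms(3) rep_in[OF assms(3)]]
  have "rep \<theta> \<circ> \<pi> \<in> relabel \<pi> \<theta>" "rep \<eta> \<circ> \<pi> \<in> relabel \<pi> \<eta>"
    using rep_in assms by (auto simp: relabel_def)
  from kdist_eq[OF relabel_in_Theta[OF assms(1,2)] this(1) relabel_in_Theta[OF assms(1,3)] this(2)]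
  show ?thesis
    unfolding kdist_def[of n \<theta> \<eta>] comp_permutation_labellings(2)[OF assms(1) t]
      kdist'_comp_permutation[OF assms(1) s t] kdist'_comp_permutation[OF assms(1) s neg_lab_in[OF t]] .
qed

lemma same_block_rep:
  assumes "\<theta> \<in> Theta n" "t \<in> \<theta>" "fst e \<in> {1..2*n}" "snd e \<in> {1..2*n}"
  shows "same_block (rep \<theta>) e = same_block t e"
  using rep_cases[OF assms(1,2)]
    labellings_values[OF Theta_class(1)[OF assms(1,2)] assms(3)]
    labellings_values[OF Theta_class(1)[OF assms(1,2)] assms(4)] assms(3,4)
  by (auto simp: same_block_def neg_lab_def)

text \<open>
  The weight of a pair in the log-likelihood ratio of \<open>s\<close> to \<open>t\<close>: it is \<open>1\<close> for a pair that \<open>s\<close> newly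
  separates and \<open>-1\<close> for a pair that \<open>s\<close> newly joins.
\<close>
definition pair_change :: "(nat \<Rightarrow> nat) \<Rightarrow> (nat \<Rightarrow> nat) \<Rightarrow> nat \<Rightarrow> nat \<Rightarrow> real" where
  "pair_change t s i j = of_bool (same_block t (i, j)) - of_bool (same_block s (i, j))"

lemma relabel_transpose_stabiliser:
  assumes "\<theta>\<^sub>0 \<in> Theta n" "u \<in> {1..2*n}" "v \<in> {1..2*n}" "rep \<theta>\<^sub>0 u = rep \<theta>\<^sub>0 v"
  shows "relabel (Transposition.transpose u v) \<theta>\<^sub>0 = \<theta>\<^sub>0"
proof -
  let ?\<pi> = "Transposition.transpose u v"
  have "t \<circ> ?\<pi> = t" if "t \<in> \<theta>\<^sub>0" for t
  proof -
    have "t u = t v"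
      using same_block_rep[OF assms(1) that, of "(u, v)"] assms(2-4) by (simp add: same_block_def)
    then show ?thesis by (auto simp: fun_eq_iff Transposition.transpose_def)
  qed
  then show ?thesis unfolding relabel_def by simp
qed

text \<open>
  Exchanging two vertices of one block of \<open>\<theta>\<^sub>0\<close> fixes \<open>\<theta>\<^sub>0\<close> and preserves the distance, so it permutes
  the ball, and the sum is merely reindexed.
\<close>
lemma sum_pair_change_transpose:
  fixes \<theta>\<^sub>0 :: "(nat \<Rightarrow> nat) set" and u v :: nat
  assumes "\<theta>\<^sub>0 \<in> Theta n" "u \<in> {1..2*n}" "v \<in> {1..2*n}" "rep \<theta>\<^sub>0 u = rep \<theta>\<^sub>0 v"
    and "i \<in> {1..2*n}" "j \<in> {1..2*n}"
  defines "\<pi> \<equiv> Transposition.transpose u v"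
  shows "(\<Sum>\<theta>\<in>kball n r \<theta>\<^sub>0. pair_change (rep \<theta>\<^sub>0) (rep \<theta>) (\<pi> i) (\<pi> j)) =
    (\<Sum>\<theta>\<in>kball n r \<theta>\<^sub>0. pair_change (rep \<theta>\<^sub>0) (rep \<theta>) i j)"
proof (rule sum.reindex_bij_witness[where i = "relabel \<pi>" and j = "relabel \<pi>"])
  have \<pi>: "\<pi> permutes {1..2*n}" unfolding \<pi>_def by (rule permutes_swap_id[OF assms(2,3)])
  fix \<theta> assume "\<theta> \<in> kball n r \<theta>\<^sub>0"
  then have \<theta>: "\<theta> \<in> Theta n" "kdist n \<theta> \<theta>\<^sub>0 \<le> r" by (auto simp: kball_def)
  show inv: "relabel \<pi> (relabel \<pi> \<theta>) = \<theta>" "relabel \<pi> (relabel \<pi> \<theta>) = \<theta>"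
    unfolding relabel_def \<pi>_def by (simp_all add: image_image comp_assoc)
  show "relabel \<pi> \<theta> \<in> kball n r \<theta>\<^sub>0" "relabel \<pi> \<theta> \<in> kball n r \<theta>\<^sub>0"
    using kdist_relabel[OF \<pi> \<theta>(1) assms(1)] relabel_in_Theta[OF \<pi> \<theta>(1)] \<theta>(2)
    unfolding \<pi>_def relabel_transpose_stabiliser[OF assms(1-4)] by (auto simp: kball_def)
  have "rep \<theta> \<circ> \<pi> \<in> relabel \<pi> \<theta>" using rep_in[OF \<theta>(1)] by (simp add: relabel_def)
  from same_block_rep[OF relabel_in_Theta[OF \<pi> \<theta>(1)] this, of "(i, j)"] assms(5,6)
  have "same_block (rep (relabel \<pi> \<theta>)) (i, j) = same_block (rep \<theta>) (\<pi> i, \<pi> j)"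
    by (simp add: same_block_def)
  moreover have "rep \<theta>\<^sub>0 (\<pi> x) = rep \<theta>\<^sub>0 x" for x
    using assms(4) by (cases "x = u"; cases "x = v") (simp_all add: \<pi>_def)
  then have "same_block (rep \<theta>\<^sub>0) (i, j) = same_block (rep \<theta>\<^sub>0) (\<pi> i, \<pi> j)"
    by (simp add: same_block_def)
  ultimately show "pair_change (rep \<theta>\<^sub>0) (rep (relabel \<pi> \<theta>)) i j = pair_change (rep \<theta>\<^sub>0) (rep \<theta>) (\<pi> i) (\<pi> j)"
    by (simp add: pair_change_def)
qed

lemma pair_change_commute: "pair_change t s i j = pair_change t s j i"
  by (auto simp: pair_change_def same_block_def)

text \<open>
  If \<open>a\<close> vertices leave the zero block then \<open>a\<close> vertices enter it, so each block of \<open>t\<close> is cut by \<open>s\<close>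
  into parts of sizes \<open>a\<close> and \<open>n - a\<close>. The pairs with one vertex in each part are newly separated; the
  factor \<open>2\<close> inside a block is due to counting ordered pairs. Across the blocks, the pairs joined are
  those of a moved vertex with an unmoved one.
\<close>
lemma sum_pair_change_blocks:
  assumes "t \<in> labellings n" "s \<in> labellings n"
  defines "blk \<equiv> \<lambda>b. {i \<in> {1..2*n}. t i = b}" and "a \<equiv> real (kdist' n t s)"
  shows "b \<in> {0, 1} \<Longrightarrow> (\<Sum>i\<in>blk b. \<Sum>j\<in>blk b. pair_change t s i j) = 2 * a * (real n - a)"
    and "(\<Sum>i\<in>blk 0. \<Sum>j\<in>blk 1. pair_change t s i j) = - (2 * a * (real n - a))"
proof -
  define m where "m = (\<lambda>b. real (card {i \<in> blk b. s i = 0}))"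
  have [simp]: "finite (blk b)" for b by (simp add: blk_def)
  have card: "card (blk 0) = n" "card (blk 1) = n"
    using assms(1) by (simp_all add: labellings_def blk_def)
  have Z: "zeros n t = blk 0" by (simp add: zeros_def blk_def)
  have sv: "s i = 0 \<or> s i = 1" "t i = 0 \<or> t i = 1" if "i \<in> {1..2*n}" for i
    using labellings_values assms(1,2) that by blast+
  have split0: "blk 0 = {i \<in> blk 0. s i = 0} \<union> (zeros n t - zeros n s)"
    by (auto simp: Z zeros_def blk_def)
  have "card (blk 0) = card {i \<in> blk 0. s i = 0} + card (zeros n t - zeros n s)"
    by (subst split0, subst card_Un_disjoint) (auto simp: zeros_def Z blk_def)
  then have m0: "m 0 = real n - a"
    using card by (simp add: m_def a_def kdist'_def)
  have "zeros n s = {i \<in> blk 0. s i = 0} \<union> {i \<in> blk 1. s i = 0}"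
    using sv by (auto simp: zeros_def blk_def)
  then have "card (zeros n s) = card {i \<in> blk 0. s i = 0} + card {i \<in> blk 1. s i = 0}"
    by (simp only:, subst card_Un_disjoint) (auto simp: blk_def)
  then have m1: "m 1 = a"
    using m0 card_zeros[OF assms(2)] by (simp add: m_def)
  have agr: "(\<Sum>i\<in>blk b. \<Sum>j\<in>blk b'. of_bool (s i = s j)) =
      m b * m b' + (real (card (blk b)) - m b) * (real (card (blk b')) - m b')" for b b'
    unfolding m_def by (rule sum_agreements) (use sv in \<open>auto simp: blk_def\<close>)
  have sh: "(\<Sum>i\<in>blk b. \<Sum>j\<in>blk b'. pair_change t s i j) =
      real (card (blk b)) * real (card (blk b')) * of_bool (b = b') -
      (m b * m b' + (real (card (blk b)) - m b) * (real (card (blk b')) - m b'))" for b b'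
  proof -
    have "(\<Sum>i\<in>blk b. \<Sum>j\<in>blk b'. pair_change t s i j) =
        (\<Sum>i\<in>blk b. \<Sum>j\<in>blk b'. of_bool (b = b') - of_bool (s i = s j))"
      by (intro sum.cong refl) (auto simp: pair_change_def same_block_def blk_def)
    then show ?thesis unfolding sum_subtractf agr by simp
  qed
  show "(\<Sum>i\<in>blk b. \<Sum>j\<in>blk b. pair_change t s i j) = 2 * a * (real n - a)" if "b \<in> {0, 1}"
  proof -
    from that consider "b = 0" | "b = 1" by blast
    then show ?thesis
    proof cases
      case 1
      show ?thesis unfolding 1 sh card m0 m1 by (simp add: algebra_simps)
    next
      case 2
      show ?thesis unfolding 2 sh card m0 m1 by (simp add: algebra_simps)
    qed
  qed
  show "(\<Sum>i\<in>blk 0. \<Sum>j\<in>blk 1. pair_change t s i j) = - (2 * a * (real n - a))"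
    unfolding sh card m0 m1 by (simp add: algebra_simps)
qed

text \<open>
  Negating a representative replaces its distance \<open>k'\<close> by \<open>n - k'\<close>, so the product below does not see
  the minimum in the definition of the metric.
\<close>
lemma kdist_times_complement:
  assumes "\<theta> \<in> Theta n" "\<eta> \<in> Theta n"
  shows "real (kdist n \<theta> \<eta>) * (real n - real (kdist n \<theta> \<eta>)) =
    real (kdist' n (rep \<theta>) (rep \<eta>)) * (real n - real (kdist' n (rep \<theta>) (rep \<eta>)))"
proof -
  note s = Theta_class(1)[OF assms(1) rep_in[OF assms(1)]]
  note t = Theta_class(1)[OF assms(2) rep_in[OF assms(2)]]
  let ?S = "zeros n (rep \<theta>)" and ?T = "zeros n (rep \<eta>)"
  have "?S - zeros n (neg_lab n (rep \<eta>)) = ?S \<inter> ?T"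
    unfolding zeros_neg_lab[OF t] by (auto simp: zeros_def)
  moreover have "card ?S = card (?S - ?T) + card (?S \<inter> ?T)"
    by (subst card_Un_disjoint[symmetric]) (auto simp: zeros_def intro!: arg_cong[where f = card])
  ultimately have "real n = real (kdist' n (rep \<theta>) (rep \<eta>)) + real (kdist' n (rep \<theta>) (neg_lab n (rep \<eta>)))"
    using card_zeros[OF s] by (simp add: kdist'_def)
  then show ?thesis unfolding kdist_def by (auto simp: min_def)
qed

text \<open>
  The coefficients of within-block edge density minus cross-block edge density.
\<close>
definition contrast :: "nat \<Rightarrow> (nat \<Rightarrow> nat) \<Rightarrow> nat \<times> nat \<Rightarrow> real" where
  "contrast n t e = (if same_block t e then 1 / (real n * (real n - 1)) else - 1 / (real n)\<^sup>2)"

lemma finite_kball: "finite (kball n r \<theta>)"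
  unfolding kball_def using finite_Theta by simp

lemma centre_in_kball: "\<theta> \<in> Theta n \<Longrightarrow> \<theta> \<in> kball n r \<theta>"
  by (simp add: kball_def kdist_def kdist'_def)

lemma card_kball_pos: "\<theta> \<in> Theta n \<Longrightarrow> card (kball n r \<theta>) > 0"
  using finite_kball[of n r \<theta>] centre_in_kball[of \<theta> n r] by (auto simp: card_gt_0_iff)

lemma sum_kdist'_kball:
  assumes "\<theta>\<^sub>0 \<in> Theta n"
  shows "(\<Sum>\<theta>\<in>kball n r \<theta>\<^sub>0. 2 * real (kdist' n (rep \<theta>\<^sub>0) (rep \<theta>)) *
      (real n - real (kdist' n (rep \<theta>\<^sub>0) (rep \<theta>)))) = real (card (kball n r \<theta>\<^sub>0)) * alpha n r \<theta>\<^sub>0"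
  using card_kball_pos[OF assms, of r] unfolding alpha_def
  by (auto intro!: sum.cong simp: kdist_times_complement[OF assms] kball_def mult.assoc)

text \<open>
  The key symmetry fact: summed over the ball, the weight of a pair depends only on whether the pair
  lies inside a block. By invariance under transpositions the weights are constant on the pairs inside
  each block and on the pairs across. The constants are the block totals, which the counts above
  express by \<open>\<alpha>\<close>, divided by the number of pairs; both blocks have the same total, hence the same
  constant.
\<close>
lemma sum_pair_change_kball:
  assumes "n \<ge> 2" "\<theta>\<^sub>0 \<in> Theta n" "e \<in> vpairs n"
  shows "(\<Sum>\<theta>\<in>kball n r \<theta>\<^sub>0. pair_change (rep \<theta>\<^sub>0) (rep \<theta>) (fst e) (snd e)) =
    real (card (kball n r \<theta>\<^sub>0)) * alpha n r \<theta>\<^sub>0 * contrast n (rep \<theta>\<^sub>0) e"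
proof -
  define t where "t = rep \<theta>\<^sub>0"
  define blk where "blk = (\<lambda>b. {i \<in> {1..2*n}. t i = b})"
  define S where "S = (\<lambda>i j. \<Sum>\<theta>\<in>kball n r \<theta>\<^sub>0. pair_change t (rep \<theta>) i j)"
  define K where "K = real (card (kball n r \<theta>\<^sub>0)) * alpha n r \<theta>\<^sub>0"
  have t: "t \<in> labellings n" unfolding t_def by (rule Theta_class(1)[OF assms(2) rep_in[OF assms(2)]])
  have tv: "t i = 0 \<or> t i = 1" if "i \<in> {1..2*n}" for i using labellings_values[OF t that] .
  have S_commute: "S i j = S j i" for i j
    unfolding S_def by (subst pair_change_commute) (rule refl)
  \<comment> \<open>A vertex of a pair may be replaced by another vertex of its block, other than its partner.\<close>
  have move: "S i' j = S i j"
    if "t i = t i'" "i \<in> {1..2*n}" "i' \<in> {1..2*n}" "j \<in> {1..2*n}" "j \<noteq> i" "j \<noteq> i'" for i i' j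
    using sum_pair_change_transpose[OF assms(2) that(2,3) _ that(2,4), of r] that
    by (simp add: S_def t_def)
  have cardb: "card (blk b) = n" if "b \<in> {0, 1}" for b
    using t that by (auto simp: blk_def labellings_def)
  have fin: "finite (blk b)" for b by (simp add: blk_def)
  have reps: "rep \<theta> \<in> labellings n" if "\<theta> \<in> kball n r \<theta>\<^sub>0" for \<theta>
    using that Theta_class(1)[OF _ rep_in] by (auto simp: kball_def)
  have swap: "(\<Sum>i\<in>blk b. \<Sum>j\<in>blk b'. S i j) =
      (\<Sum>\<theta>\<in>kball n r \<theta>\<^sub>0. \<Sum>i\<in>blk b. \<Sum>j\<in>blk b'. pair_change t (rep \<theta>) i j)" for b b'
    unfolding S_def by (simp only: sum.swap[where B = "kball n r \<theta>\<^sub>0"])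
  have block: "(\<Sum>i\<in>blk b. \<Sum>j\<in>blk b. S i j) = K" if "b \<in> {0, 1}" for b
    unfolding swap K_def sum_kdist'_kball[OF assms(2), symmetric]
    using sum_pair_change_blocks(1)[OF t reps that] by (intro sum.cong) (auto simp: blk_def t_def)
  have cross: "(\<Sum>i\<in>blk 0. \<Sum>j\<in>blk 1. S i j) = - K"
    unfolding swap K_def sum_kdist'_kball[OF assms(2), symmetric] sum_negf[symmetric]
    using sum_pair_change_blocks(2)[OF t reps] by (intro sum.cong) (auto simp: blk_def t_def)
  obtain i j where e: "e = (i, j)" "i \<in> {1..2*n}" "j \<in> {1..2*n}" "i \<noteq> j"
    using assms(3) by (auto simp: vpairs_def)
  have crossval: "S i j = - K / (real n)\<^sup>2" if ij: "i \<in> blk 0" "j \<in> blk 1" for i j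
  proof -
    have "S i' j' = S i j" if "i' \<in> blk 0" "j' \<in> blk 1" for i' j'
    proof -
      have "S i' j' = S i j'" by (rule move) (use that ij in \<open>auto simp: blk_def\<close>)
      also have "\<dots> = S j' i" by (rule S_commute)
      also have "\<dots> = S j i" by (rule move) (use that ij in \<open>auto simp: blk_def\<close>)
      finally show ?thesis by (simp add: S_commute)
    qed
    then have "(\<Sum>i\<in>blk 0. \<Sum>j\<in>blk 1. S i j) = (\<Sum>i'\<in>blk 0. \<Sum>j'\<in>blk 1. S i j)"
      by (intro sum.cong) auto
    then have "- K = real n * (real n * S i j)" unfolding cross by (simp add: cardb)
    then show ?thesis using assms(1) by (simp add: field_simps power2_eq_square)
  qed
  have "S i j = K * contrast n t e"
  proof (cases "t i = t j")
    case True
    define b where "b = t i"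
    have b: "b \<in> {0, 1}" "i \<in> blk b" "j \<in> blk b"
      using tv e True by (auto simp: b_def blk_def)
    have diag: "S i' i' = 0" for i' by (simp add: S_def pair_change_def same_block_def)
    have const: "S i' j' = S i j" if ij': "i' \<in> blk b" "j' \<in> blk b" "i' \<noteq> j'" for i' j'
    proof -
      have mv: "S x y = S x' y" if "x \<in> blk b" "x' \<in> blk b" "y \<in> blk b" "y \<noteq> x" "y \<noteq> x'" for x x' y
        by (rule move) (use that in \<open>auto simp: blk_def\<close>)
      show ?thesis
        \<comment> \<open>The pairs are moved onto each other one vertex at a time; if the second vertex is already
          \<open>i\<close>, moving the first one to \<open>i\<close> would collide, and it is moved to \<open>j\<close> instead.\<close>
      proof (cases "j' = i")
        case True
        show ?thesis
        proof (cases "i' = j")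
          case True
          then show ?thesis using \<open>j' = i\<close> S_commute by simp
        next
          case False
          have "S i' j' = S j j'" by (rule mv) (use b ij' e True False in auto)
          then show ?thesis using True S_commute by simp
        qed
      next
        case False
        have "S i' j' = S i j'" by (rule mv) (use b ij' False in auto)
        also have "\<dots> = S j' i" by (rule S_commute)
        also have "\<dots> = S j i" by (rule mv) (use b ij' e False in auto)
        finally show ?thesis using S_commute by simp
      qed
    qed
    have row: "(\<Sum>j'\<in>blk b. S i' j') = (real n - 1) * S i j" if "i' \<in> blk b" for i'
    proof -
      have "(\<Sum>j'\<in>blk b. S i' j') = S i' i' + (\<Sum>j'\<in>blk b - {i'}. S i' j')"
        using sum.remove[OF fin that] .
      also have "(\<Sum>j'\<in>blk b - {i'}. S i' j') = (\<Sum>j'\<in>blk b - {i'}. S i j)"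
        by (rule sum.cong) (use const that in auto)
      finally show ?thesis
        using that b fin cardb[OF b(1)] assms(1) by (simp add: diag card_Diff_singleton of_nat_diff)
    qed
    have "K = real n * ((real n - 1) * S i j)"
      using block[OF b(1)] by (simp add: row cardb[OF b(1)])
    then show ?thesis using True assms(1) by (simp add: contrast_def same_block_def e)
  next
    case False
    have "S i j = - K / (real n)\<^sup>2"
    proof (cases "t i = 0")
      case True
      then show ?thesis using crossval[of i j] False tv[OF e(3)] e(2,3) by (simp add: blk_def)
    next
      case ne: False
      then show ?thesis
        using crossval[of j i] False tv[OF e(2)] tv[OF e(3)] e(2,3) S_commute[of i j] by (simp add: blk_def)
    qed
    then show ?thesis using False by (simp add: contrast_def same_block_def e)
  qed
  then show ?thesis by (simp add: S_def K_def t_def e)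
qed


section \<open>The likelihood of a ball\<close>

lemma exp_average_le:
  fixes l :: "'a \<Rightarrow> real"
  assumes "finite B" "B \<noteq> {}"
  shows "real (card B) * exp ((\<Sum>\<theta>\<in>B. l \<theta>) / real (card B)) \<le> (\<Sum>\<theta>\<in>B. exp (l \<theta>))"
proof -
  define m where "m = (\<Sum>\<theta>\<in>B. l \<theta>) / real (card B)"
  have card: "real (card B) > 0" using assms by (simp add: card_gt_0_iff)
  \<comment> \<open>The tangent at the mean lies below the exponential, and its linear part averages out.\<close>
  have "exp m * (1 + (l \<theta> - m)) \<le> exp (l \<theta>)" for \<theta>
  proof -
    have "exp m * (1 + (l \<theta> - m)) \<le> exp m * exp (l \<theta> - m)"
      by (intro mult_left_mono exp_ge_add_one_self) auto
    then show ?thesis by (simp add: exp_diff)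
  qed
  then have "(\<Sum>\<theta>\<in>B. exp m * (1 + (l \<theta> - m))) \<le> (\<Sum>\<theta>\<in>B. exp (l \<theta>))"
    by (intro sum_mono)
  moreover have "(\<Sum>\<theta>\<in>B. exp m * (1 + (l \<theta> - m))) = exp m * (real (card B) + ((\<Sum>\<theta>\<in>B. l \<theta>) - real (card B) * m))"
    by (simp add: sum_distrib_left[symmetric] sum.distrib sum_subtractf)
  ultimately show ?thesis using card by (simp add: m_def mult.commute)
qed

definition log_odds_ratio :: "real \<Rightarrow> real \<Rightarrow> real" where
  "log_odds_ratio p q = ln (q * (1 - p) / (p * (1 - q)))"

definition density_gap :: "nat \<Rightarrow> (nat \<Rightarrow> nat) \<Rightarrow> nat set set \<Rightarrow> real" where
  "density_gap n t x = (\<Sum>e\<in>vpairs n. contrast n t e * of_bool (adj x e))"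

lemma ln_rho:
  assumes "0 < p" "p < 1" "0 < q" "q < 1"
  shows "rho p q > 0" "ln (rho p q) = - \<bar>log_odds_ratio p q\<bar>"
proof -
  let ?l = "log_odds_ratio p q"
  have "(1 - p) / p * (q / (1 - q)) = exp ?l"
    using assms by (simp add: log_odds_ratio_def field_simps)
  moreover have "p / (1 - p) * ((1 - q) / q) = exp (- ?l)"
    using assms by (simp add: log_odds_ratio_def exp_minus field_simps)
  ultimately have "rho p q = exp (- \<bar>?l\<bar>)" by (simp add: rho_def min_def abs_if)
  then show "rho p q > 0" "ln (rho p q) = - \<bar>?l\<bar>" by simp_all
qed

text \<open>
  The first sum vanishes because both densities are normalised; it removes the additive constant of the
  log-likelihood ratio. The other two are the mean and the variance of \<open>density_gap\<close>.
\<close>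
lemma sum_contrast:
  assumes "n \<ge> 2" "t \<in> labellings n"
  shows "(\<Sum>e\<in>vpairs n. contrast n t e) = 0"
    and "(\<Sum>e\<in>vpairs n. contrast n t e * edge_prob p q t e) = p - q"
    and "(\<Sum>e\<in>vpairs n. (contrast n t e)\<^sup>2 * (edge_prob p q t e * (1 - edge_prob p q t e))) =
      p * (1 - p) / (real n * (real n - 1)) + q * (1 - q) / (real n)\<^sup>2"
  using assms(1)
    sum_same_block_vpairs[OF assms(2), of "\<lambda>b. if b then 1 / (real n * (real n - 1)) else - 1 / (real n)\<^sup>2"]
    sum_same_block_vpairs[OF assms(2), of "\<lambda>b. if b then p / (real n * (real n - 1)) else - q / (real n)\<^sup>2"]
    sum_same_block_vpairs[OF assms(2), of "\<lambda>b. if b then (1 / (real n * (real n - 1)))\<^sup>2 * (p * (1 - p))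
      else (1 / (real n)\<^sup>2)\<^sup>2 * (q * (1 - q))"]
  by (simp_all add: contrast_def edge_prob_def if_distrib if_distribR power2_eq_square cong: if_cong)

lemma density_gap_deviation:
  assumes "n \<ge> 2" "t \<in> labellings n" "0 < p" "p < 1" "0 < q" "q < 1" "\<tau> > 0"
  shows "measure_pmf.prob (lab_law n p q t) {x. \<tau> \<le> \<bar>density_gap n t x - (p - q)\<bar>}
    \<le> (p * (1 - p) / (real n * (real n - 1)) + q * (1 - q) / (real n)\<^sup>2) / \<tau>\<^sup>2"
  using edge_statistic_deviation[OF assms(3-7), of n t "contrast n t"]
  unfolding density_gap_def sum_contrast[OF assms(1,2)] .

lemma alpha_nonneg:
  assumes "\<theta>\<^sub>0 \<in> Theta n"
  shows "alpha n r \<theta>\<^sub>0 \<ge> 0"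
proof -
  have "kdist n \<theta>\<^sub>0 \<theta> \<le> n" for \<theta>
  proof -
    have "kdist' n (rep \<theta>\<^sub>0) (rep \<theta>) \<le> card (zeros n (rep \<theta>\<^sub>0))"
      unfolding kdist'_def by (rule card_mono) (auto simp: zeros_def)
    then show ?thesis
      using card_zeros[OF Theta_class(1)[OF assms rep_in[OF assms]]] by (simp add: kdist_def)
  qed
  then show ?thesis unfolding alpha_def by (intro mult_nonneg_nonneg sum_nonneg) auto
qed

text \<open>
  Convexity bounds the average likelihood ratio over the ball by the exponential of the average
  log-likelihood ratio, and the symmetry of the ball turns the latter into a multiple of the density
  gap.
\<close>
lemma ball_likelihood_ge:
  assumes "n \<ge> 2" "\<theta>\<^sub>0 \<in> Theta n" "x \<in> graphs n" "0 < p" "p < 1" "0 < q" "q < 1"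
  shows "real (card (kball n r \<theta>\<^sub>0)) * pmf (planted_law n p q \<theta>\<^sub>0) x *
      exp (alpha n r \<theta>\<^sub>0 * (log_odds_ratio p q * density_gap n (rep \<theta>\<^sub>0) x))
    \<le> (\<Sum>\<theta>\<in>kball n r \<theta>\<^sub>0. pmf (planted_law n p q \<theta>) x)"
proof -
  define B where "B = kball n r \<theta>\<^sub>0"
  define t where "t = rep \<theta>\<^sub>0"
  define L where "L = (\<lambda>\<theta>. pmf (planted_law n p q \<theta>) x)"
  define kap where "kap = ln ((1 - q) / (1 - p))"
  define X where "X = (\<lambda>e. log_odds_ratio p q * of_bool (adj x e) + kap)"
  have t: "t \<in> labellings n" unfolding t_def by (rule Theta_class(1)[OF assms(2) rep_in[OF assms(2)]])
  have B: "finite B" "B \<noteq> {}" "card B > 0"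
    using finite_kball[of n r \<theta>\<^sub>0] centre_in_kball[OF assms(2), of r] by (auto simp: B_def card_gt_0_iff)
  have L: "L \<theta> > 0" for \<theta>
    unfolding L_def planted_law_def by (rule ln_likelihood_ratio(1)[OF assms(3-7)])
  have "(\<Sum>\<theta>\<in>B. ln (L \<theta> / L \<theta>\<^sub>0)) =
      (\<Sum>\<theta>\<in>B. \<Sum>e\<in>vpairs n. pair_change t (rep \<theta>) (fst e) (snd e) * X e)"
    unfolding L_def planted_law_def
    by (simp only: ln_likelihood_ratio(2)[OF assms(3-7)] pair_change_def X_def t_def kap_def log_odds_ratio_def prod.collapse)
  also have "\<dots> = (\<Sum>e\<in>vpairs n. (\<Sum>\<theta>\<in>B. pair_change t (rep \<theta>) (fst e) (snd e)) * X e)"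
    by (subst sum.swap) (simp add: sum_distrib_right)
  also have "\<dots> = (\<Sum>e\<in>vpairs n. real (card B) * alpha n r \<theta>\<^sub>0 * contrast n t e * X e)"
    unfolding B_def t_def
    by (intro sum.cong refl) (subst sum_pair_change_kball, use assms B in \<open>auto simp: B_def\<close>)
  also have "\<dots> = (\<Sum>e\<in>vpairs n. real (card B) * alpha n r \<theta>\<^sub>0 *
      (log_odds_ratio p q * (contrast n t e * of_bool (adj x e)) + kap * contrast n t e))"
    by (intro sum.cong refl) (simp only: X_def algebra_simps)
  also have "\<dots> = real (card B) * alpha n r \<theta>\<^sub>0 *
      (log_odds_ratio p q * density_gap n t x + kap * (\<Sum>e\<in>vpairs n. contrast n t e))"
    unfolding density_gap_def sum_distrib_left[symmetric] sum.distrib ..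
  finally have avg: "(\<Sum>\<theta>\<in>B. ln (L \<theta> / L \<theta>\<^sub>0)) / real (card B) =
      alpha n r \<theta>\<^sub>0 * (log_odds_ratio p q * density_gap n t x)"
    using sum_contrast(1)[OF assms(1) t] B by simp
  have "real (card B) * exp (alpha n r \<theta>\<^sub>0 * (log_odds_ratio p q * density_gap n t x))
      \<le> (\<Sum>\<theta>\<in>B. exp (ln (L \<theta> / L \<theta>\<^sub>0)))"
    using exp_average_le[OF B(1,2), of "\<lambda>\<theta>. ln (L \<theta> / L \<theta>\<^sub>0)"] unfolding avg .
  also have "\<dots> = (\<Sum>\<theta>\<in>B. L \<theta>) / L \<theta>\<^sub>0"
    unfolding sum_divide_distrib by (intro sum.cong refl) (simp add: L divide_pos_pos)
  finally show ?thesis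
    using L[of \<theta>\<^sub>0] by (simp add: L_def B_def t_def field_simps)
qed

text \<open>
  Whatever the sign of \<open>p - q\<close>, the exponent is at least \<open>- \<alpha> * \<bar>\<lambda>\<bar> * \<bar>U\<bar>\<close>, and \<open>- \<bar>\<lambda>\<bar>\<close> is \<open>ln \<rho>\<close>; so a
  bound on \<open>\<bar>U\<bar>\<close> suffices.
\<close>
lemma ball_likelihood_ge_rho:
  assumes "n \<ge> 2" "\<theta>\<^sub>0 \<in> Theta n" "x \<in> graphs n" "0 < p" "p < 1" "0 < q" "q < 1"
    and "\<bar>density_gap n (rep \<theta>\<^sub>0) x - (p - q)\<bar> < (c - 1) * \<bar>p - q\<bar>"
  shows "real (card (kball n r \<theta>\<^sub>0)) * pmf (planted_law n p q \<theta>\<^sub>0) x *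
      rho p q powr (c * alpha n r \<theta>\<^sub>0 * \<bar>p - q\<bar>)
    \<le> (\<Sum>\<theta>\<in>kball n r \<theta>\<^sub>0. pmf (planted_law n p q \<theta>) x)"
proof -
  let ?l = "log_odds_ratio p q" and ?U = "density_gap n (rep \<theta>\<^sub>0) x"
  have "\<bar>?U\<bar> \<le> \<bar>?U - (p - q)\<bar> + \<bar>p - q\<bar>" by linarith
  also have "\<dots> \<le> c * \<bar>p - q\<bar>" using assms(8) by (simp add: algebra_simps)
  finally have "\<bar>?l\<bar> * \<bar>?U\<bar> \<le> \<bar>?l\<bar> * (c * \<bar>p - q\<bar>)" by (intro mult_left_mono) auto
  then have "- \<bar>?l\<bar> * (c * \<bar>p - q\<bar>) \<le> ?l * ?U"
    using abs_ge_minus_self[of "?l * ?U"] by (simp add: abs_mult)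
  then have "ln (rho p q) * (c * \<bar>p - q\<bar>) \<le> ?l * ?U" by (simp add: ln_rho[OF assms(4-7)])
  from mult_left_mono[OF this alpha_nonneg[OF assms(2), of r]]
  have "rho p q powr (c * alpha n r \<theta>\<^sub>0 * \<bar>p - q\<bar>) \<le> exp (alpha n r \<theta>\<^sub>0 * (?l * ?U))"
    using ln_rho(1)[OF assms(4-7)] by (simp add: powr_def algebra_simps)
  from mult_left_mono[OF this, of "real (card (kball n r \<theta>\<^sub>0)) * pmf (planted_law n p q \<theta>\<^sub>0) x"]
  show ?thesis using ball_likelihood_ge[OF assms(1-7), of r] by simp
qed

section \<open>Missing the true parameter\<close>

text \<open>
  The first term bounds the probability that the density gap deviates from its mean by at least
  \<open>(c - 1) * \<bar>p - q\<bar>\<close>. Where it does not, the power of \<open>\<rho>\<close> times the likelihood of \<open>\<theta>\<^sub>0\<close> is at most the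
  average likelihood over the ball, hence on \<open>E\<close> at most \<open>a\<close> times the total likelihood divided by the
  size of the ball. The total likelihood sums over \<open>E\<close> to at most the number of parameters, and the
  quotient of the two cardinalities is the inverse of the prior mass.
\<close>
lemma low_posterior_ball_prob:
  assumes "n \<ge> 2" "\<theta>\<^sub>0 \<in> Theta n" "0 < p" "p < 1" "0 < q" "q < 1" "p \<noteq> q" "c > 1"
    and "E \<subseteq> graphs n"
    and low: "\<And>x. x \<in> E \<Longrightarrow> (\<Sum>\<theta>\<in>kball n r \<theta>\<^sub>0. pmf (planted_law n p q \<theta>) x)
      \<le> a * (\<Sum>\<theta>\<in>Theta n. pmf (planted_law n p q \<theta>) x)"
    and "a \<ge> 0"
  shows "measure_pmf.prob (planted_law n p q \<theta>\<^sub>0) E \<le>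
    (p * (1 - p) / (real n * (real n - 1)) + q * (1 - q) / (real n)\<^sup>2) / ((c - 1)\<^sup>2 * (p - q)\<^sup>2) +
    (a / measure_pmf.prob (prior n) (kball n r \<theta>\<^sub>0)) / rho p q powr (c * alpha n r \<theta>\<^sub>0 * \<bar>p - q\<bar>)"
proof -
  define B where "B = kball n r \<theta>\<^sub>0"
  define t where "t = rep \<theta>\<^sub>0"
  define d where "d = rho p q powr (c * alpha n r \<theta>\<^sub>0 * \<bar>p - q\<bar>)"
  define \<tau> where "\<tau> = (c - 1) * \<bar>p - q\<bar>"
  define M where "M = planted_law n p q \<theta>\<^sub>0"
  define F where "F = {x. \<tau> \<le> \<bar>density_gap n t x - (p - q)\<bar>}"
  have t: "t \<in> labellings n" unfolding t_def by (rule Theta_class(1)[OF assms(2) rep_in[OF assms(2)]])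
  have \<tau>: "\<tau> > 0" using assms(7,8) by (simp add: \<tau>_def)
  have d: "d > 0" using ln_rho(1)[OF assms(3-6)] by (simp add: d_def)
  have B: "finite B" "B \<subseteq> Theta n" "card B > 0"
    using finite_kball[of n r \<theta>\<^sub>0] card_kball_pos[OF assms(2), of r] by (auto simp: B_def kball_def)
  have fin: "finite E"
  proof (rule finite_subset[OF assms(9)])
    have "{{i, j} | i j. (i, j) \<in> vpairs n} = (\<lambda>(i, j). {i, j}) ` vpairs n" by auto
    then show "finite (graphs n)" unfolding graphs_def by (simp add: finite_vpairs)
  qed
  have "real (card B) * d * measure_pmf.prob M (E - F) =
      (\<Sum>x\<in>E - F. real (card B) * pmf M x * d)"
    using fin by (subst measure_measure_pmf_finite) (simp_all add: sum_distrib_left mult_ac)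
  also have "\<dots> \<le> (\<Sum>x\<in>E - F. a * (\<Sum>\<theta>\<in>Theta n. pmf (planted_law n p q \<theta>) x))"
  proof (rule sum_mono)
    fix x assume x: "x \<in> E - F"
    then have "real (card B) * pmf M x * d \<le> (\<Sum>\<theta>\<in>B. pmf (planted_law n p q \<theta>) x)"
      unfolding M_def B_def d_def
      by (intro ball_likelihood_ge_rho) (use assms in \<open>auto simp: F_def \<tau>_def t_def\<close>)
    then show "real (card B) * pmf M x * d \<le> a * (\<Sum>\<theta>\<in>Theta n. pmf (planted_law n p q \<theta>) x)"
      using low[of x] x unfolding B_def by auto
  qed
  also have "\<dots> = a * (\<Sum>\<theta>\<in>Theta n. measure_pmf.prob (planted_law n p q \<theta>) (E - F))"
    unfolding sum_distrib_left[symmetric] using fin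
    by (simp add: sum.swap[where B = "Theta n"] measure_measure_pmf_finite)
  also have "\<dots> \<le> a * (\<Sum>\<theta>\<in>Theta n. 1)"
    by (intro mult_left_mono sum_mono assms) auto
  finally have main: "real (card B) * d * measure_pmf.prob M (E - F) \<le> a * real (card (Theta n))"
    by simp
  have b: "measure_pmf.prob (prior n) B = real (card B) / real (card (Theta n))"
    unfolding prior_def using B(2)
    by (subst measure_pmf_of_set) (auto simp: Theta_nonempty finite_Theta Int_absorb1)
  have "card (Theta n) > 0" by (simp add: card_gt_0_iff Theta_nonempty finite_Theta)
  then have 1: "measure_pmf.prob M (E - F) \<le> (a / measure_pmf.prob (prior n) B) / d"
    using main d B(3) unfolding b by (simp add: field_simps)
  have "measure_pmf.prob M E \<le> measure_pmf.prob M (F \<union> (E - F))"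
    by (intro measure_pmf.finite_measure_mono) auto
  also have "\<dots> \<le> measure_pmf.prob M F + measure_pmf.prob M (E - F)"
    by (rule measure_Un_le) auto
  also have "measure_pmf.prob M F \<le>
      (p * (1 - p) / (real n * (real n - 1)) + q * (1 - q) / (real n)\<^sup>2) / \<tau>\<^sup>2"
    unfolding M_def F_def planted_law_def t_def[symmetric]
    by (rule density_gap_deviation) (use assms t \<tau> in auto)
  finally show ?thesis
    using 1 by (simp add: \<tau>_def M_def d_def B_def power_mult_distrib)
qed

text \<open>
  Every graph has positive probability for every parameter, so the credibility bound, which holds
  almost surely under the prior predictive law, holds for each graph.
\<close>
lemma credible_miss_low_ball:
  assumes "credible_sets p q a D" "n \<ge> 1" "x \<in> graphs n"
    and pq: "0 < p n" "p n < 1" "0 < q n" "q n < 1"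
    and "associated n r C (D n x)" "\<theta>\<^sub>0 \<in> Theta n" "\<theta>\<^sub>0 \<notin> C"
  shows "(\<Sum>\<theta>\<in>kball n r \<theta>\<^sub>0. pmf (planted_law n (p n) (q n) \<theta>) x)
    \<le> a n * (\<Sum>\<theta>\<in>Theta n. pmf (planted_law n (p n) (q n) \<theta>) x)"
proof -
  let ?L = "\<lambda>\<theta>. pmf (planted_law n (p n) (q n) \<theta>) x"
  have "?L \<theta> > 0" for \<theta>
    unfolding planted_law_def by (rule ln_likelihood_ratio(1)[OF assms(3) pq])
  then have pos: "(\<Sum>\<theta>\<in>Theta n. ?L \<theta>) > 0"
    by (intro sum_pos) (auto simp: finite_Theta Theta_nonempty)
  then have "x \<in> set_pmf (prior_predictive n (p n) (q n))"
    unfolding set_pmf_iff pmf_prior_predictive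
    using finite_Theta[of n] Theta_nonempty[of n] by auto
  then have "posterior n (p n) (q n) (Theta n - D n x) x \<le> a n"
    using assms(1,2) by (auto simp: credible_sets_def AE_measure_pmf_iff)
  then have "(\<Sum>\<theta>\<in>Theta n - D n x. ?L \<theta>) \<le> a n * (\<Sum>\<theta>\<in>Theta n. ?L \<theta>)"
    using pos by (simp add: posterior_def pos_divide_le_eq)
  moreover have "kball n r \<theta>\<^sub>0 \<subseteq> Theta n - D n x"
    using assms(8-10) by (auto simp: associated_def kball_def)
  then have "(\<Sum>\<theta>\<in>kball n r \<theta>\<^sub>0. ?L \<theta>) \<le> (\<Sum>\<theta>\<in>Theta n - D n x. ?L \<theta>)"
    by (intro sum_mono2) (auto simp: finite_Theta)
  ultimately show ?thesis by linarith
qed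

text \<open>
  The condition on the square roots implies the one on the standard deviations, since
  \<open>p - q = (sqrt p - sqrt q) * (sqrt p + sqrt q)\<close> and the standard deviations sum up to at most
  \<open>sqrt p + sqrt q\<close>.
\<close>
lemma sqrt_gap_imp_sd_smallo:
  fixes p q :: "nat \<Rightarrow> real"
  assumes pq: "eventually (\<lambda>n. 0 < p n \<and> p n < 1 \<and> 0 < q n \<and> q n < 1) sequentially"
    and gap: "filterlim (\<lambda>n. real n * (sqrt (p n) - sqrt (q n))) at_top sequentially"
  shows "(\<lambda>n. sqrt (p n) * sqrt (1 - p n) + sqrt (q n) * sqrt (1 - q n))
    \<in> o(\<lambda>n. real n * \<bar>p n - q n\<bar>)"
proof (rule landau_o.smallI)
  fix \<epsilon> :: real assume \<epsilon>: "\<epsilon> > 0"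
  have "eventually (\<lambda>n. 1 / \<epsilon> \<le> real n * (sqrt (p n) - sqrt (q n))) sequentially"
    using gap by (simp add: filterlim_at_top)
  then show "eventually (\<lambda>n. norm (sqrt (p n) * sqrt (1 - p n) + sqrt (q n) * sqrt (1 - q n))
      \<le> \<epsilon> * norm (real n * \<bar>p n - q n\<bar>)) sequentially"
    using pq
  proof eventually_elim
    case (elim n)
    let ?s = "sqrt (p n) + sqrt (q n)"
    note pqn = elim(2)
    have le: "sqrt (p n) * sqrt (1 - p n) \<le> sqrt (p n)" "sqrt (q n) * sqrt (1 - q n) \<le> sqrt (q n)"
      using pqn by (auto intro!: mult_right_le_one_le)
    have nn: "0 \<le> sqrt (p n) * sqrt (1 - p n)" "0 \<le> sqrt (q n) * sqrt (1 - q n)" using pqn by auto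
    have "p n - q n = (sqrt (p n) - sqrt (q n)) * ?s"
      using pqn by (simp add: algebra_simps)
    then have w: "real n * (p n - q n) = (real n * (sqrt (p n) - sqrt (q n))) * ?s" by simp
    have "?s = \<epsilon> * (1 / \<epsilon> * ?s)" using \<epsilon> by simp
    also have "\<dots> \<le> \<epsilon> * (real n * (p n - q n))"
      unfolding w using elim(1) \<epsilon> pqn by (intro mult_left_mono mult_right_mono) auto
    also have "\<dots> \<le> \<epsilon> * norm (real n * \<bar>p n - q n\<bar>)"
      using \<epsilon> by (intro mult_left_mono) (auto simp: abs_mult mult_left_mono)
    finally show ?case using le nn by simp
  qed
qed

lemma relative_variance_tendsto_0:
  fixes p q :: "nat \<Rightarrow> real"
  assumes pq: "eventually (\<lambda>n. 0 < p n \<and> p n < 1 \<and> 0 < q n \<and> q n < 1) sequentially"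
    and sd: "(\<lambda>n. sqrt (p n) * sqrt (1 - p n) + sqrt (q n) * sqrt (1 - q n))
      \<in> o(\<lambda>n. real n * \<bar>p n - q n\<bar>)"
  shows "eventually (\<lambda>n. p n \<noteq> q n) sequentially"
    and "(\<lambda>n. (p n * (1 - p n) / (real n * (real n - 1)) + q n * (1 - q n) / (real n)\<^sup>2) / (p n - q n)\<^sup>2)
      \<longlonglongrightarrow> 0"
proof -
  let ?h = "\<lambda>n. sqrt (p n) * sqrt (1 - p n) + sqrt (q n) * sqrt (1 - q n)"
  let ?V = "\<lambda>n. p n * (1 - p n) / (real n * (real n - 1)) + q n * (1 - q n) / (real n)\<^sup>2"
  show "eventually (\<lambda>n. p n \<noteq> q n) sequentially"
    using landau_o.smallD[OF sd zero_less_one] pq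
  proof eventually_elim
    case (elim n)
    have "?h n > 0" using elim(2) by (intro add_pos_pos mult_pos_pos) auto
    then show ?case using elim(1) by auto
  qed
  have "(\<lambda>n. 2 * (?h n / (real n * \<bar>p n - q n\<bar>))\<^sup>2) \<longlonglongrightarrow> 2 * 0\<^sup>2"
    by (intro tendsto_intros smalloD_tendsto sd)
  then have lim: "(\<lambda>n. 2 * (?h n / (real n * \<bar>p n - q n\<bar>))\<^sup>2) \<longlonglongrightarrow> 0" by simp
  show "(\<lambda>n. ?V n / (p n - q n)\<^sup>2) \<longlonglongrightarrow> 0"
  proof (rule tendsto_sandwich[OF _ _ tendsto_const lim])
    show "eventually (\<lambda>n. 0 \<le> ?V n / (p n - q n)\<^sup>2) sequentially"
      using eventually_ge_at_top[of 2] pq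
    proof eventually_elim
      case (elim n)
      then show ?case by (intro divide_nonneg_nonneg add_nonneg_nonneg mult_nonneg_nonneg) auto
    qed
    show "eventually (\<lambda>n. ?V n / (p n - q n)\<^sup>2 \<le> 2 * (?h n / (real n * \<bar>p n - q n\<bar>))\<^sup>2) sequentially"
      using eventually_ge_at_top[of 2] pq
    proof eventually_elim
      case (elim n)
      have pqn: "0 < p n" "p n < 1" "0 < q n" "q n < 1" using elim by auto
      let ?P = "p n * (1 - p n)" and ?Q = "q n * (1 - q n)"
      have h: "?P + ?Q \<le> (?h n)\<^sup>2"
        using pqn by (simp add: power2_sum power_mult_distrib)
      have "(real n)\<^sup>2 / 2 \<le> real n * (real n - 1)"
      proof -
        have "2 * real n \<le> real n * real n" by (intro mult_right_mono) (use elim in auto)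
        then show ?thesis by (simp add: power2_eq_square algebra_simps)
      qed
      then have "?P / (real n * (real n - 1)) \<le> ?P / ((real n)\<^sup>2 / 2)"
        using elim pqn by (intro divide_left_mono) auto
      moreover have "?Q / (real n)\<^sup>2 \<le> ?Q / ((real n)\<^sup>2 / 2)"
        using elim pqn by (intro divide_left_mono) auto
      ultimately have "?V n \<le> ?P / ((real n)\<^sup>2 / 2) + ?Q / ((real n)\<^sup>2 / 2)"
        by (rule add_mono)
      also have "\<dots> = 2 * (?P + ?Q) / (real n)\<^sup>2"
        by (simp add: add_divide_distrib distrib_left mult.commute)
      also have "\<dots> \<le> 2 * (?h n)\<^sup>2 / (real n)\<^sup>2" using h by (intro divide_right_mono) auto
      finally have "?V n / (p n - q n)\<^sup>2 \<le> (2 * (?h n)\<^sup>2 / (real n)\<^sup>2) / (p n - q n)\<^sup>2"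
        by (rule divide_right_mono) auto
      then show ?case by (simp add: power_divide power_mult_distrib)
    qed
  qed
qed

theorem theorem4p5:
  fixes k :: "nat \<Rightarrow> nat" and p q a :: "nat \<Rightarrow> real" and c :: real
    and \<theta>\<^sub>0 :: "nat \<Rightarrow> (nat \<Rightarrow> nat) set"
    and D C :: "nat \<Rightarrow> nat set set \<Rightarrow> (nat \<Rightarrow> nat) set set"
  assumes "\<And>n. n \<ge> 1 \<Longrightarrow> k n \<ge> 1"
    and "\<And>n. n \<ge> 1 \<Longrightarrow> 0 < p n \<and> p n < 1"
    and "\<And>n. n \<ge> 1 \<Longrightarrow> 0 < q n \<and> q n < 1"
    and "(\<lambda>n. p n - q n) \<in> o(\<lambda>n. 1 / real n)"
    and "(\<lambda>n. sqrt (p n) * sqrt (1 - p n) + sqrt (q n) * sqrt (1 - q n))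
           \<in> o(\<lambda>n. real n * \<bar>p n - q n\<bar>)
         \<or> (p \<longlonglongrightarrow> 0 \<and> q \<longlonglongrightarrow> 0 \<and>
            filterlim (\<lambda>n. real n * (sqrt (p n) - sqrt (q n))) at_top sequentially)"
    and "\<And>n. n \<ge> 1 \<Longrightarrow> \<theta>\<^sub>0 n \<in> Theta n"
    and "c > 1"
    and "\<And>n. n \<ge> 1 \<Longrightarrow> 0 \<le> a n \<and> a n \<le> 1"
    and "credible_sets p q a D"
    and "(\<lambda>n. a n / measure_pmf.prob (prior n) (kball n (k n) (\<theta>\<^sub>0 n)))
           \<in> o(\<lambda>n. rho (p n) (q n) powr (c * alpha n (k n) (\<theta>\<^sub>0 n) * \<bar>p n - q n\<bar>))"
    and "\<And>n x. n \<ge> 1 \<Longrightarrow> x \<in> graphs n \<Longrightarrow> associated n (k n) (C n x) (D n x)"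
  shows "(\<lambda>n. measure_pmf.prob (planted_law n (p n) (q n) (\<theta>\<^sub>0 n)) {x. \<theta>\<^sub>0 n \<in> C n x})
           \<longlonglongrightarrow> 1"
proof -
  let ?M = "\<lambda>n. planted_law n (p n) (q n) (\<theta>\<^sub>0 n)"
  let ?miss = "\<lambda>n. {x \<in> graphs n. \<theta>\<^sub>0 n \<notin> C n x}"
  let ?V = "\<lambda>n. (p n * (1 - p n) / (real n * (real n - 1)) + q n * (1 - q n) / (real n)\<^sup>2)"
  let ?b = "\<lambda>n. a n / measure_pmf.prob (prior n) (kball n (k n) (\<theta>\<^sub>0 n))"
  let ?d = "\<lambda>n. rho (p n) (q n) powr (c * alpha n (k n) (\<theta>\<^sub>0 n) * \<bar>p n - q n\<bar>)"
  have pq: "eventually (\<lambda>n. 0 < p n \<and> p n < 1 \<and> 0 < q n \<and> q n < 1) sequentially"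
    using eventually_ge_at_top[of 1] by eventually_elim (use assms(2,3) in auto)
  have sd: "(\<lambda>n. sqrt (p n) * sqrt (1 - p n) + sqrt (q n) * sqrt (1 - q n))
      \<in> o(\<lambda>n. real n * \<bar>p n - q n\<bar>)"
    using assms(5) sqrt_gap_imp_sd_smallo[OF pq] by blast
  note rv = relative_variance_tendsto_0[OF pq sd]
  have cover: "measure_pmf.prob (?M n) {x. \<theta>\<^sub>0 n \<in> C n x} = 1 - measure_pmf.prob (?M n) (?miss n)" for n
  proof -
    have "measure_pmf.prob (?M n) (?miss n) = measure_pmf.prob (?M n) (- {x. \<theta>\<^sub>0 n \<in> C n x})"
      by (rule measure_prob_cong_0)
        (use set_planted_law[of n "p n" "q n" "\<theta>\<^sub>0 n"] in \<open>auto simp: set_pmf_eq\<close>)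
    then show ?thesis using measure_pmf.prob_compl[of "{x. \<theta>\<^sub>0 n \<in> C n x}" "?M n"]
      by (simp add: Compl_eq_Diff_UNIV)
  qed
  have "(\<lambda>n. ?V n / (p n - q n)\<^sup>2 / (c - 1)\<^sup>2 + ?b n / ?d n) \<longlonglongrightarrow> 0 / (c - 1)\<^sup>2 + 0"
    using assms(7) by (intro tendsto_intros rv(2) smalloD_tendsto assms(10)) auto
  then have lim: "(\<lambda>n. ?V n / (p n - q n)\<^sup>2 / (c - 1)\<^sup>2 + ?b n / ?d n) \<longlonglongrightarrow> 0" by simp
  have "(\<lambda>n. measure_pmf.prob (?M n) (?miss n)) \<longlonglongrightarrow> 0"
  proof (rule tendsto_sandwich[OF _ _ tendsto_const lim])
    show "eventually (\<lambda>n. measure_pmf.prob (?M n) (?miss n)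
        \<le> ?V n / (p n - q n)\<^sup>2 / (c - 1)\<^sup>2 + ?b n / ?d n) sequentially"
      using rv(1) eventually_ge_at_top[of 2]
    proof eventually_elim
      case (elim n)
      then have n: "n \<ge> 1" by simp
      have "measure_pmf.prob (?M n) (?miss n) \<le> ?V n / ((c - 1)\<^sup>2 * (p n - q n)\<^sup>2) + ?b n / ?d n"
      proof (rule low_posterior_ball_prob)
        fix x assume "x \<in> ?miss n"
        then show "(\<Sum>\<theta>\<in>kball n (k n) (\<theta>\<^sub>0 n). pmf (planted_law n (p n) (q n) \<theta>) x)
            \<le> a n * (\<Sum>\<theta>\<in>Theta n. pmf (planted_law n (p n) (q n) \<theta>) x)"
          using assms(2,3,6)[OF n] assms(11)[OF n]
          by (intro credible_miss_low_ball[OF assms(9) n]) auto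
      qed (use elim assms(2,3,6,8)[OF n] assms(7) in auto)
      then show ?case by (simp add: mult.commute)
    qed
  qed simp
  then have "(\<lambda>n. 1 - measure_pmf.prob (?M n) (?miss n)) \<longlonglongrightarrow> 1 - 0"
    by (intro tendsto_intros)
  then show ?thesis unfolding cover by simp
qed

end
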